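(* Let $C_1,\dots,C_\ell$ be configurations with $k$ spokes each, let $\mathcal{NP}_k$ be the set of all caps on $k$ spokes, and let $a_1(n),\dots,a_\ell(n)$ be polynomials in $n$. If $$\sum_{i=1}^{\ell} a_i(n)\,\llbracket C_i\# Cap\rrbracket_n=0$$ holds for all caps $Cap\in\mathcal{NP}_k$, then for any ribbon graph $\Gamma$ with a $k$-spoke configuration removed, such that the spokes are unique (pairwise distinct edges) in $\Gamma$, $$\sum_{i=1}^{\ell} a_i(n)\,P(\Gamma\# C_i)=0,$$ where $\Gamma\# C_i$ is the ribbon graph obtained by inserting $C_i$ in place of the removed configuration and $P(\Gamma\# C_i)=[\Gamma\# C_i]_n$ is its Penrose polynomial.
   Context: Ribbon graphs and Penrose polynomial. A ribbon graph $\Gamma$ of a finite graph $G(V,E)$ is a compact surface made of vertex discs and edge ribbons. Its Penrose polynomial is $[\Gamma]_n:=[\Gamma_E^\flat]_n$, where the blowup $\Gamma_E^\flat$ replaces each degree-$d$ vertex by a $d$-cycle (boundary of the vertex disc) with canonical perfect matching $E$, and the bracket replaces each matching edge by (0-smoothing) $-$ (1-smoothing) and gives each closed circle the value $n$ (multiplicatively). The 0-smoothing deletes the edge and joins the four remaining strands along the two sides of its ribbon; the 1-smoothing does the same after inserting an extra half-twist in the ribbon. Explicitly, $[\Gamma]_n=\sum_{A\subseteq E}(-1)^{|A|}n^{b(A)}$, with $b(A)$ the number of boundary circles of the ribbon surface after inserting an extra half-twist in each edge of $A$. Buckles. A buckle is a marking at which two strands of a diagram interact. It is resolved by the buckle bracket: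 a diagram with a buckle equals the diagram with the buckle removed, minus the diagram with the buckle replaced by a node; a node means the two arcs are fused, i.e. treated as one circle. Circles have value $n$ (multiplicatively). Thus for a collection of circles with a finite set $B$ of buckles, $\llbracket\cdot\rrbracket_n=\sum_{A\subseteq B}(-1)^{|A|}n^{c(A)}$, where $c(A)$ is the number of classes of circles after fusing along the buckles in $A$. BM polynomial. $\llbracket\cdot\rrbracket_n$ is computed by replacing each matching edge by (0-smoothing with one buckle between the two resulting strands) $-$ (1-smoothing with one buckle between the two resulting strands), resolving all buckles, and evaluating circles as $n$. Configurations and caps. A $k$-spoke configuration is a piece of a ribbon graph lying in a disc (virtual crossings allowed) whose edges meet the boundary of the disc in exactly $k$ points, the spoke ends; the edges meeting the boundary are the spokes and are part of the configuration. All edges of the configuration (including spokes) are regarded as matching edges of its blowup. Each spoke end gives two strand ends (the two sides of the spoke's ribbon) on the boundary, so there are $2k$ strand ends. A cap on $k$ spokes (not necessarily planar) consists of a way of connecting the $2k$ strand ends in pairs by $k$ arcs outside the disc, together with a set of pairs of these arcs, each of which is marked with a buckle (pairs of arcs that already interact along a spoke are not marked). $\mathcal{NP}_k$ is the finite set of all caps on $k$ spokes. The capped configuration $C\# Cap$ (equivalently $Cap\# C$) is the perfect matching graph decorated with buckles obtained by gluing the cap's arcs to the blowup of $C$ along the strand ends, and $\llbracket C\# Cap\rrbracket_n$ is its BM polynomial (sum over smoothings of all edges of $C$, with the buckles of the cap retained and resolved). "$\Gamma$ with a $k$-spoke configuration removed" means the exterior of a disc containing a $k$-spoke configuration in a ribbon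 graph; any $k$-spoke configuration may be inserted into the disc by matching up the spoke ends. *)

theory Defs
  imports "HOL-Computational_Algebra.Polynomial" "HOL-Library.Disjoint_Sets"
begin

definition components :: "'a set \<Rightarrow> ('a \<times> 'a) set \<Rightarrow> 'a set set" where
  "components S R = S // (R \<union> R\<inverse>)\<^sup>*"

definition fpf_involution_on :: "'a set \<Rightarrow> ('a \<Rightarrow> 'a) \<Rightarrow> bool" where
  "fpf_involution_on S f \<longleftrightarrow> (\<forall>x\<in>S. f x \<in> S \<and> f x \<noteq> x \<and> f (f x) = x)"

text \<open>
  The two strand ends at the \<open>j\<close>-th spoke end are \<open>(j, False)\<close> and \<open>(j, True)\<close>, the two
  sides of the spoke's ribbon in the order in which they are met along the boundary of the disc.
\<close>

definition strand_ends :: "nat \<Rightarrow> (nat \<times> bool) set" where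
  "strand_ends k = {..<k} \<times> UNIV"

text \<open>
  Ribbon graphs, orientable or not, are encoded by the corners of their edge ribbons (flags,
  four to each edge). For a corner \<open>x\<close>,
  \<^item> \<open>cross x\<close> is the other corner of the same end of the ribbon,
  \<^item> \<open>along x\<close> is the corner at the other end of the same side of the ribbon,
  \<^item> \<open>arc x\<close> is the corner reached from \<open>x\<close> by following the boundary of the vertex disc
    away from the ribbon, up to the next ribbon end.

  A vertex of degree \<open>d > 0\<close> is thus an orbit of \<open>cross\<close> and \<open>arc\<close> with \<open>2 d\<close> corners, and the
  edges of the \<open>d\<close>-cycle replacing it in the blowup are the pairs \<open>{x, arc x}\<close>. A vertex of
  degree \<open>0\<close> has no corners; it is recorded by one element of \<open>discs\<close>.

  A piece of a ribbon graph cut off by a circle that meets the ribbons in \<open>k\<close> spoke ends (the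
  part inside or the part outside the circle) is encoded in the same way; a ribbon graph is the
  case \<open>k = 0\<close>. A ribbon end on the circle is not attached to a vertex, so \<open>arc\<close> is meaningful
  only at the other corners; the corners on the circle are \<open>strand (j, b)\<close>. As virtual crossings
  are allowed, nothing else about the way the piece lies in the disc is relevant.
\<close>

record 'f piece =
  flags :: "'f set"
  discs :: "'f set"
  cross :: "'f \<Rightarrow> 'f"
  along :: "'f \<Rightarrow> 'f"
  arc :: "'f \<Rightarrow> 'f"
  strand :: "nat \<times> bool \<Rightarrow> 'f"

definition is_piece :: "nat \<Rightarrow> 'f piece \<Rightarrow> bool" where
  "is_piece k G \<longleftrightarrow>
     finite (flags G) \<and> finite (discs G) \<and> flags G \<inter> discs G = {} \<and>
     fpf_involution_on (flags G) (cross G) \<and>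
     fpf_involution_on (flags G) (along G) \<and>
     (\<forall>x\<in>flags G. along G x \<noteq> cross G x \<and> along G (cross G x) = cross G (along G x)) \<and>
     inj_on (strand G) (strand_ends k) \<and> strand G ` strand_ends k \<subseteq> flags G \<and>
     (\<forall>j<k. \<forall>b. cross G (strand G (j, b)) = strand G (j, \<not> b)) \<and>
     fpf_involution_on (flags G - strand G ` strand_ends k) (arc G)"

definition edge_of :: "'f piece \<Rightarrow> 'f \<Rightarrow> 'f set" where
  "edge_of G x = {x, cross G x, along G x, along G (cross G x)}"

definition edges :: "'f piece \<Rightarrow> 'f set set" where
  "edges G = edge_of G ` flags G"

text \<open>
  For \<open>G\<close> the part of a ribbon graph outside the circle: no ribbon portion leaves the circle
  at one spoke end and returns to it at another one without meeting a vertex, which would make the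
  two spokes the same edge of the ribbon graph.
\<close>

definition spokes_unique :: "nat \<Rightarrow> 'f piece \<Rightarrow> bool" where
  "spokes_unique k G \<longleftrightarrow> inj_on (\<lambda>j. edge_of G (strand G (j, False))) {..<k}"


text \<open>
  The edges in \<open>A\<close> are 1-smoothed, the others are 0-smoothed; equivalently, an extra half-twist
  is inserted in the edges in \<open>A\<close> and the boundary of the resulting surface is followed.
\<close>

definition smooth :: "'f piece \<Rightarrow> 'f set set \<Rightarrow> 'f \<Rightarrow> 'f" where
  "smooth G A x = (if edge_of G x \<in> A then along G (cross G x) else along G x)"

definition circles :: "'f piece \<Rightarrow> 'f set set \<Rightarrow> 'f set set" where
  "circles G A = components (flags G \<union> discs G)
     ((\<lambda>x. (x, arc G x)) ` flags G \<union> (\<lambda>x. (x, smooth G A x)) ` flags G)"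

definition penrose :: "'f piece \<Rightarrow> 'a::comm_ring_1 poly" where
  "penrose G = (\<Sum>A\<in>Pow (edges G). (-1) ^ card A * monom 1 (card (circles G A)))"

text \<open>
  \<open>touch b\<close> is the set of the circles on which the strands at the buckle \<open>b\<close> lie; it is a
  singleton if both strands lie on the same circle.
\<close>

definition buckle_bracket ::
  "'c set \<Rightarrow> 'b set \<Rightarrow> ('b \<Rightarrow> 'c set) \<Rightarrow> 'a::comm_ring_1 poly" where
  "buckle_bracket Circ B touch =
     (\<Sum>D\<in>Pow B. (-1) ^ card D * monom 1 (card (components Circ (\<Union>b\<in>D. touch b \<times> touch b))))"

text \<open>
  The edges of the closed piece \<open>G\<close> are the matching edges, and \<open>M\<close> is a set of further buckles,
  each given as a pair \<open>{m, m'}\<close> of arcs \<open>m = {x, arc x}\<close>, \<open>m' = {y, arc y}\<close>. The four corners of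
  an edge lie on the two strands resulting from either smoothing, two on each, so the buckle on a
  smoothed edge lies between the circles that meet the edge. The sum type keeps this buckle
  distinct from the buckles in \<open>M\<close>.
\<close>

definition bm_polynomial :: "'f piece \<Rightarrow> 'f set set set \<Rightarrow> 'a::comm_ring_1 poly" where
  "bm_polynomial G M =
     (\<Sum>A\<in>Pow (edges G). (-1) ^ card A *
        buckle_bracket (circles G A) (edges G <+> M)
          (\<lambda>b. {c \<in> circles G A. c \<inter> (case b of Inl e \<Rightarrow> e | Inr m \<Rightarrow> \<Union>m) \<noteq> {}}))"


text \<open>
  A cap is a pair of a perfect matching of the strand ends (the arcs) and a set of
  unordered pairs of arcs (the buckles).
\<close>

type_synonym cap = "(nat \<times> bool) set set \<times> (nat \<times> bool) set set set"

definition share_spoke :: "(nat \<times> bool) set \<Rightarrow> (nat \<times> bool) set \<Rightarrow> bool" where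
  "share_spoke m m' \<longleftrightarrow> (\<exists>j b. (j, b) \<in> m \<and> (j, \<not> b) \<in> m')"

definition caps :: "nat \<Rightarrow> cap set" where
  "caps k = {(M, Q). partition_on (strand_ends k) M \<and> (\<forall>m\<in>M. card m = 2) \<and>
     Q \<subseteq> {{m, m'} |m m'. m \<in> M \<and> m' \<in> M \<and> m \<noteq> m' \<and> \<not> share_spoke m m'}}"

definition close_up :: "nat \<Rightarrow> 'f piece \<Rightarrow> cap \<Rightarrow> 'f piece" where
  "close_up k C Cap = C\<lparr>arc := (\<lambda>x. if x \<in> strand C ` strand_ends k
     then (THE y. {x, y} \<in> (\<lambda>m. strand C ` m) ` fst Cap) else arc C x)\<rparr>"

definition bm_capped :: "nat \<Rightarrow> 'f piece \<Rightarrow> cap \<Rightarrow> 'a::comm_ring_1 poly" where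
  "bm_capped k C Cap =
     bm_polynomial (close_up k C Cap) ((\<lambda>q. (\<lambda>m. strand C ` m) ` q) ` snd Cap)"


text \<open>
  Inserting \<open>C\<close> into the exterior \<open>G\<close> glues the two ribbon ends at each spoke end. The ribbon
  portions that are glued together form a single edge, so the corners on the
  circle disappear, and the side of a ribbon that starts at a remaining corner is followed
  through all the portions, up to the remaining corner at which it ends.
\<close>

definition insert_config :: "nat \<Rightarrow> 'g piece \<Rightarrow> 'f piece \<Rightarrow> ('g + 'f) piece" where
  "insert_config k G C =
     (let F = flags G <+> flags C;
          K = strand G ` strand_ends k <+> strand C ` strand_ends k;
          R = (\<lambda>x. (x, map_sum (along G) (along C) x)) ` F \<union>
              (\<lambda>p. (Inl (strand G p), Inr (strand C p))) ` strand_ends k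
      in \<lparr>flags = F - K,
          discs = discs G <+> discs C,
          cross = map_sum (cross G) (cross C),
          along = (\<lambda>x. THE y. y \<in> F - K \<and> y \<noteq> x \<and> (x, y) \<in> (R \<union> R\<inverse>)\<^sup>*),
          arc = map_sum (arc G) (arc C),
          strand = (\<lambda>_. undefined)\<rparr>)"

end

theory Submission
  imports Defs "HOL-Library.FuncSet"
begin

text \<open>
  At \<open>n\<close> in the naturals all polynomials involved are state sums over colourings of the flags with \<open>n\<close>
  colours that are constant along the arcs: an edge contributes the weight [its 0-smoothing
  respects the colours] - [its 1-smoothing respects the colours], and a buckle forbids equal
  colours. The weight of an edge vanishes if its two strands have the same colour, so the buckles
  on edges are automatic and the Penrose polynomial is the BM polynomial without further buckles.

  Cutting along the circle, \<open>P(\<Gamma> # C)(n)\<close> is the sum over the colourings \<open>\<kappa>\<close> of the strand ends of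
  an exterior factor, which depends only on the kernel of \<open>\<kappa>\<close> as it is invariant under
  permutations of the colours, times an interior factor. So it suffices that the
  interior factors, combined with the \<open>a\<^sub>i\<close>, cancel over all \<open>\<kappa>\<close> with a given kernel. They vanish
  unless all colour classes of \<open>\<kappa>\<close> are even and the two ends on a spoke differ. In that case some
  matching of the strand ends refines the kernel, and writing "equal" as 1 - "different"
  expresses the sum over a fixed kernel through caps with that matching.
\<close>

section \<open>Colourings and the buckle bracket\<close>

text \<open>Serves two opposite purposes: an arc of a cap has to be monochrome, whereas the strands
  that meet at a buckle must not be.\<close>

definition monochrome :: "('a \<Rightarrow> 'c) \<Rightarrow> 'a set \<Rightarrow> bool" where
  "monochrome g X \<longleftrightarrow> (\<forall>x\<in>X. \<forall>y\<in>X. g x = g y)"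

lemma monochrome_cong: "(\<And>x. x \<in> X \<Longrightarrow> g x = h x) \<Longrightarrow> monochrome g X \<longleftrightarrow> monochrome h X"
  by (simp add: monochrome_def)

lemma monochrome_image: "monochrome g (f ` X) \<longleftrightarrow> monochrome (g \<circ> f) X"
  by (auto simp: monochrome_def)

lemma prod_of_bool:
  "finite A \<Longrightarrow> (\<Prod>x\<in>A. of_bool (P x)) = (of_bool (\<forall>x\<in>A. P x) :: 'a::comm_semiring_1)"
  by (induction A rule: finite_induct) auto

text \<open>Expands the product of the factors \<open>1 - of_bool (P b)\<close>. With
  \<open>P b\<close> standing for a fusion at \<open>b\<close> it resolves buckles; with
  \<open>P\<close> negated it later trades equalities of colours for buckles.\<close>

lemma sum_alternating_of_bool:
  assumes "finite B"
  shows "(\<Sum>D\<in>Pow B. (-1) ^ card D * of_bool (\<forall>b\<in>D. P b)) =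
         (of_bool (\<forall>b\<in>B. \<not> P b) :: 'a::comm_ring_1)"
proof -
  have "(of_bool (\<forall>b\<in>B. \<not> P b) :: 'a) = (\<Prod>b\<in>B. 1 - of_bool (P b))"
    using prod_of_bool[OF assms, of "\<lambda>b. \<not> P b", where 'a = 'a]
    by (simp add: of_bool_not_iff)
  also have "\<dots> = (\<Sum>D\<in>Pow B. (-1) ^ card D * (\<Prod>b\<in>D. of_bool (P b)))"
    by (subst prod_diff_conv_sum[OF assms]) simp
  also have "\<dots> = (\<Sum>D\<in>Pow B. (-1) ^ card D * of_bool (\<forall>b\<in>D. P b))"
    by (intro sum.cong refl arg_cong2[where f = "(*)"] prod_of_bool)
       (auto intro: finite_subset[OF _ assms])
  finally show ?thesis by simp
qed

section \<open>Circle counts as numbers of colourings\<close>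

lemma of_nat_card_filter:
  "finite A \<Longrightarrow> of_nat (card {x \<in> A. P x}) = (\<Sum>x\<in>A. of_bool (P x) :: 'a::comm_semiring_1)"
  by (simp add: of_bool_def sum.If_cases Int_def)

text \<open>Each class may be coloured freely, and a colouring constant along \<open>R\<close>
  factors through the classes. Taking extensional functions on both sides makes the correspondence
  bijective.\<close>

lemma bij_betw_colourings_components:
  assumes R: "R \<subseteq> S \<times> S"
  defines "E \<equiv> (R \<union> R\<inverse>)\<^sup>*"
  shows "bij_betw (\<lambda>f. \<lambda>x\<in>S. f (E `` {x})) (components S R \<rightarrow>\<^sub>E {..<n})
           {g \<in> S \<rightarrow>\<^sub>E {..<n::nat}. \<forall>(x, y)\<in>R. g x = g y}"
proof -
  have E: "equiv UNIV E"
    unfolding E_def by (simp add: equiv_def refl_rtrancl trans_rtrancl sym_rtrancl sym_Un_converse)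
  have comp: "components S R = S // E"
    by (simp add: components_def E_def)
  \<comment> \<open>The closure is reflexive on the whole type; as \<open>R\<close> stays within
    \<open>S\<close>, so do the classes of the points of \<open>S\<close>.\<close>
  have ES: "x \<in> S \<longleftrightarrow> y \<in> S" if "(x, y) \<in> E" for x y
    using that unfolding E_def by (induction rule: rtrancl_induct) (use R in auto)
  have class_eq: "E `` {x} = E `` {y}" if "(x, y) \<in> E" for x y
    using that E by (rule equiv_class_eq[rotated])
  have const: "g x = g y" if "(x, y) \<in> E" "\<forall>(x, y)\<in>R. g x = g y" for g :: "'a \<Rightarrow> nat" and x y
    using that(1) unfolding E_def by (induction rule: rtrancl_induct) (use that(2) in auto)
  have some: "(x, SOME y. y \<in> E `` {x}) \<in> E" for x
    using someI[of "\<lambda>y. y \<in> E `` {x}" x] E by (auto simp: equiv_def refl_on_def)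
  have some_S: "(SOME y. y \<in> c) \<in> S" "E `` {SOME y. y \<in> c} = c" if "c \<in> S // E" for c
  proof -
    obtain x where x: "x \<in> S" "c = E `` {x}"
      using \<open>c \<in> S // E\<close> by (rule quotientE)
    then show "(SOME y. y \<in> c) \<in> S" "E `` {SOME y. y \<in> c} = c"
      unfolding x(2) using x(1) ES[OF some[of x]] class_eq[OF some[of x]] by blast+
  qed
  show ?thesis
    unfolding comp
  proof (rule bij_betw_byWitness[where f' = "\<lambda>g. \<lambda>c\<in>S // E. g (SOME x. x \<in> c)"])
    show "\<forall>f\<in>S // E \<rightarrow>\<^sub>E {..<n}.
      (\<lambda>c\<in>S // E. (\<lambda>x\<in>S. f (E `` {x})) (SOME x. x \<in> c)) = f"
      using some_S by (auto simp: fun_eq_iff PiE_def extensional_def)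
    show "\<forall>g\<in>{g \<in> S \<rightarrow>\<^sub>E {..<n}. \<forall>(x, y)\<in>R. g x = g y}.
      (\<lambda>x\<in>S. (\<lambda>c\<in>S // E. g (SOME x. x \<in> c)) (E `` {x})) = g"
    proof (intro ballI ext)
      fix g x
      assume g: "g \<in> {g \<in> S \<rightarrow>\<^sub>E {..<n}. \<forall>(x, y)\<in>R. g x = g y}"
      then show "(\<lambda>x\<in>S. (\<lambda>c\<in>S // E. g (SOME x. x \<in> c)) (E `` {x})) x = g x"
        using const[OF some[of x], of g] quotientI[of x S E]
        by (auto simp: PiE_def extensional_def)
    qed
    show "(\<lambda>f. \<lambda>x\<in>S. f (E `` {x})) ` (S // E \<rightarrow>\<^sub>E {..<n})
      \<subseteq> {g \<in> S \<rightarrow>\<^sub>E {..<n}. \<forall>(x, y)\<in>R. g x = g y}"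
    proof safe
      fix f x y assume "f \<in> S // E \<rightarrow>\<^sub>E {..<n}" and xy: "(x, y) \<in> R"
      have "(x, y) \<in> E" unfolding E_def using xy by auto
      then show "(\<lambda>x\<in>S. f (E `` {x})) x = (\<lambda>x\<in>S. f (E `` {x})) y"
        using class_eq[of x y] ES[of x y] by simp
    qed (auto simp: PiE_def Pi_def intro!: quotientI)
    show "(\<lambda>g. \<lambda>c\<in>S // E. g (SOME x. x \<in> c)) ` {g \<in> S \<rightarrow>\<^sub>E {..<n}. \<forall>(x, y)\<in>R. g x = g y}
      \<subseteq> S // E \<rightarrow>\<^sub>E {..<n}"
      using some_S(1) by (auto simp: PiE_def Pi_def)
  qed
qed

lemma finite_components: "finite S \<Longrightarrow> finite (components S R)"
  by (simp add: components_def quotient_def)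

lemma finite_colourings: "finite S \<Longrightarrow> finite {g \<in> S \<rightarrow>\<^sub>E {..<n::nat}. P g}"
  by (simp add: finite_PiE)

text \<open>Turns the value \<open>n\<close> of a circle into a free choice among \<open>n\<close>
  colours.\<close>

lemma power_card_components:
  assumes "finite S" "R \<subseteq> S \<times> S"
  shows "n ^ card (components S R) = card {g \<in> S \<rightarrow>\<^sub>E {..<n}. \<forall>(x, y)\<in>R. g x = g y}"
  using bij_betw_same_card[OF bij_betw_colourings_components[OF assms(2), of n]]
    finite_components[OF assms(1)] by (simp add: card_PiE)

text \<open>This is the subset expansion of a chromatic polynomial, with the circles as vertices:
  each power of \<open>n\<close> counts the colourings constant on fused circles, and the
  alternating sum leaves those in which no buckle sees only one colour.\<close>

lemma poly_buckle_bracket: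
  fixes S :: "'s set" and pts :: "'b \<Rightarrow> 's set"
  assumes "finite S" "R \<subseteq> S \<times> S" "finite B" and pts: "\<And>b. b \<in> B \<Longrightarrow> pts b \<subseteq> S"
  shows "poly (buckle_bracket (components S R) B (\<lambda>b. {c \<in> components S R. c \<inter> pts b \<noteq> {}})) (of_nat n) =
    (of_nat (card {g \<in> S \<rightarrow>\<^sub>E {..<n}. (\<forall>(x, y)\<in>R. g x = g y) \<and> (\<forall>b\<in>B. \<not> monochrome g (pts b))})
       :: 'a::comm_ring_1)"
proof -
  define E where "E = (R \<union> R\<inverse>)\<^sup>*"
  define T where "T = (\<lambda>b. {c \<in> components S R. c \<inter> pts b \<noteq> {}})"
  let ?F = "components S R \<rightarrow>\<^sub>E {..<n}"
  let ?G = "{g \<in> S \<rightarrow>\<^sub>E {..<n}. \<forall>(x, y)\<in>R. g x = g y}"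
  have fin: "finite (components S R)" "finite ?F"
    using finite_components[OF assms(1)] by (simp_all add: finite_PiE)
  have E: "equiv UNIV E"
    unfolding E_def by (simp add: equiv_def refl_rtrancl trans_rtrancl sym_rtrancl sym_Un_converse)
  have comp: "components S R = S // E"
    by (simp add: components_def E_def)
  have ES: "x \<in> S \<longleftrightarrow> y \<in> S" if "(x, y) \<in> E" for x y
    using that unfolding E_def by (induction rule: rtrancl_induct) (use assms(2) in auto)
  \<comment> \<open>The circles met by \<open>pts b\<close> are the classes of its points, so the
    colours of these circles are the colours seen on \<open>pts b\<close>.\<close>
  have T: "T b = (\<lambda>x. E `` {x}) ` pts b" if b: "b \<in> B" for b
  proof -
    have "c = E `` {y}" if "c \<in> S // E" "y \<in> c" for c y
      using that E by (auto elim!: quotientE simp: equiv_class_eq_iff[of UNIV])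
    moreover have "y \<in> E `` {y}" for y using E by (auto simp: equiv_def refl_on_def)
    ultimately show ?thesis
      using pts[OF b] by (auto simp: T_def comp intro!: quotientI) blast
  qed
  have T_sub: "T b \<subseteq> components S R" for b
    by (auto simp: T_def)
  have mono: "monochrome f (T b) \<longleftrightarrow> monochrome (\<lambda>x\<in>S. f (E `` {x})) (pts b)"
    if "b \<in> B" for f :: "'s set \<Rightarrow> nat" and b
    unfolding T[OF that] monochrome_image using pts[OF that] by (auto intro!: monochrome_cong)
  \<comment> \<open>Fusion is again a matter of components, now of a relation on the set of circles,
    so the same count of colourings applies one level up.\<close>
  have "poly (buckle_bracket (components S R) B T) (of_nat n :: 'a) =
    (\<Sum>D\<in>Pow B. (-1) ^ card D *
       of_nat (card {f \<in> ?F. \<forall>(c, d)\<in>(\<Union>b\<in>D. T b \<times> T b). f c = f d}))"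
    unfolding buckle_bracket_def poly_sum
    by (intro sum.cong refl, subst power_card_components[OF fin(1), symmetric])
       (use T_sub in \<open>auto simp: poly_monom\<close>)
  also have "\<dots> = (\<Sum>D\<in>Pow B. \<Sum>f\<in>?F. (-1) ^ card D * of_bool (\<forall>b\<in>D. monochrome f (T b)))"
    by (intro sum.cong refl, subst of_nat_card_filter[OF fin(2)])
       (auto simp: sum_distrib_left monochrome_def of_bool_def intro!: sum.cong)
  also have "\<dots> = (\<Sum>f\<in>?F. of_bool (\<forall>b\<in>B. \<not> monochrome f (T b)))"
    by (subst sum.swap) (simp add: sum_alternating_of_bool[OF assms(3)])
  also have "\<dots> = (\<Sum>f\<in>?F. of_bool (\<forall>b\<in>B. \<not> monochrome (\<lambda>x\<in>S. f (E `` {x})) (pts b)))"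
    by (simp add: mono)
  also have "\<dots> = (\<Sum>g\<in>?G. of_bool (\<forall>b\<in>B. \<not> monochrome g (pts b)))"
    using sum.reindex_bij_betw[OF bij_betw_colourings_components[OF assms(2), of n, folded E_def],
        of "\<lambda>g. of_bool (\<forall>b\<in>B. \<not> monochrome g (pts b)) :: 'a"] by simp
  also have "\<dots> = of_nat (card {g \<in> ?G. \<forall>b\<in>B. \<not> monochrome g (pts b)})"
    by (rule of_nat_card_filter[symmetric]) (use assms(1) in \<open>auto intro: finite_colourings\<close>)
  finally show ?thesis
    by (simp add: T_def conj_assoc)
qed

section \<open>State sums over the edges\<close>

text \<open>With colours \<open>p\<close>, \<open>q\<close> at the two corners of one end and
  \<open>r\<close>, \<open>s\<close> at their images under \<open>along\<close>, this is
  \<open>[p = r][q = s] - [p = s][q = r]\<close>, the antisymmetrized product of two deltas.\<close>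

definition edge_weight :: "'f piece \<Rightarrow> ('f \<Rightarrow> nat) \<Rightarrow> 'f set \<Rightarrow> 'a::comm_ring_1" where
  "edge_weight G g e =
     of_bool (\<forall>x\<in>e. g (along G x) = g x) - of_bool (\<forall>x\<in>e. g (along G (cross G x)) = g x)"

text \<open>No condition is imposed along the edges, which enter through their weights, nor at the
  corners on the circle, where \<open>arc\<close> has no meaning. Elements of \<open>discs\<close>
  are coloured freely, as each is a circle of its own.\<close>

definition colourings :: "nat \<Rightarrow> nat \<Rightarrow> 'f piece \<Rightarrow> ('f \<Rightarrow> nat) set" where
  "colourings k n G = {g \<in> flags G \<union> discs G \<rightarrow>\<^sub>E {..<n}.
     \<forall>x\<in>flags G - strand G ` strand_ends k. g (arc G x) = g x}"

section \<open>Basic facts on pieces and their edges\<close>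

lemma strand_ends_0 [simp]: "strand_ends 0 = {}"
  by (simp add: strand_ends_def)

lemma finite_strand_ends [simp]: "finite (strand_ends k)"
  by (simp add: strand_ends_def)

lemma finite_colourings_piece: "is_piece k G \<Longrightarrow> finite (colourings k n G)"
  by (simp add: colourings_def is_piece_def finite_colourings)

lemma finite_edges: "is_piece k G \<Longrightarrow> finite (edges G)"
  by (simp add: edges_def is_piece_def)

lemma is_piece_cross:
  assumes "is_piece k G" "x \<in> flags G"
  shows "cross G x \<in> flags G" "cross G x \<noteq> x" "cross G (cross G x) = x"
  using assms by (auto simp: is_piece_def fpf_involution_on_def)

lemma is_piece_along:
  assumes "is_piece k G" "x \<in> flags G"
  shows "along G x \<in> flags G" "along G x \<noteq> x" "along G (along G x) = x"
    "along G x \<noteq> cross G x" "along G (cross G x) = cross G (along G x)"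
  using assms by (auto simp: is_piece_def fpf_involution_on_def)

lemma is_piece_arc:
  assumes "is_piece k G" "x \<in> flags G" "x \<notin> strand G ` strand_ends k"
  shows "arc G x \<in> flags G" "arc G x \<notin> strand G ` strand_ends k" "arc G x \<noteq> x" "arc G (arc G x) = x"
  using assms by (auto simp: is_piece_def fpf_involution_on_def)

lemma is_piece_strand:
  assumes "is_piece k G" "p \<in> strand_ends k"
  shows "strand G p \<in> flags G" "cross G (strand G p) = strand G (fst p, \<not> snd p)"
    "(fst p, \<not> snd p) \<in> strand_ends k"
  using assms by (auto simp: is_piece_def strand_ends_def)

lemma is_piece_cross_strand_iff:
  assumes "is_piece k G" "x \<in> flags G"
  shows "cross G x \<in> strand G ` strand_ends k \<longleftrightarrow> x \<in> strand G ` strand_ends k"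
proof -
  have "cross G y \<in> strand G ` strand_ends k" if "y \<in> strand G ` strand_ends k" for y
    using that is_piece_strand[OF assms(1)] by auto
  from this[of x] this[of "cross G x"] show ?thesis
    using is_piece_cross[OF assms] by auto
qed

lemma edge_of_subset: "is_piece k G \<Longrightarrow> x \<in> flags G \<Longrightarrow> edge_of G x \<subseteq> flags G"
  by (simp add: edge_of_def is_piece_cross is_piece_along(1))

lemma edge_of_eq:
  assumes "is_piece k G" "x \<in> flags G" "y \<in> edge_of G x"
  shows "edge_of G y = edge_of G x"
  using assms(3) unfolding edge_of_def
  by (auto simp: is_piece_cross[OF assms(1)] is_piece_along[OF assms(1)] assms(2))

lemma edge_of_self [simp]: "x \<in> edge_of G x"
  by (simp add: edge_of_def)

lemma edges_subset: "is_piece k G \<Longrightarrow> e \<in> edges G \<Longrightarrow> e \<subseteq> flags G"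
  using edge_of_subset[of k G] by (auto simp: edges_def)

text \<open>Multiplying out, \<open>A\<close> collects the edges whose 1-smoothing term is chosen.
  Since the edges partition the flags, the conditions gathered from all edges amount to a single one
  on the flags.\<close>

lemma prod_edge_weight:
  assumes G: "is_piece k G"
  shows "(\<Prod>e\<in>edges G. edge_weight G g e) =
    (\<Sum>A\<in>Pow (edges G). (-1) ^ card A *
       of_bool (\<forall>x\<in>flags G. g (smooth G A x) = g x) :: 'a::comm_ring_1)"
proof -
  let ?zero = "\<lambda>e. \<forall>x\<in>e. g (along G x) = g x"
  let ?one = "\<lambda>e. \<forall>x\<in>e. g (along G (cross G x)) = g x"
  have smooth_iff: "(\<forall>x\<in>flags G. g (smooth G A x) = g x) \<longleftrightarrow>
      (\<forall>e\<in>A. ?one e) \<and> (\<forall>e\<in>edges G - A. ?zero e)" if "A \<subseteq> edges G" for A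
  proof -
    have "(\<forall>x\<in>flags G. g (smooth G A x) = g x) \<longleftrightarrow>
        (\<forall>e\<in>edges G. \<forall>x\<in>e. g (smooth G A x) = g x)"
    proof (intro iffI ballI)
      fix e x
      assume "\<forall>x\<in>flags G. g (smooth G A x) = g x" "e \<in> edges G" "x \<in> e"
      then show "g (smooth G A x) = g x"
        using edges_subset[OF G] by blast
    next
      fix x
      assume "\<forall>e\<in>edges G. \<forall>x\<in>e. g (smooth G A x) = g x" "x \<in> flags G"
      then show "g (smooth G A x) = g x"
        using edge_of_self[of x G] unfolding edges_def by blast
    qed
    also have "\<dots> \<longleftrightarrow> (\<forall>e\<in>edges G. if e \<in> A then ?one e else ?zero e)"
    proof (intro ball_cong refl)
      fix e assume "e \<in> edges G"
      \<comment> \<open>All corners of \<open>e\<close> lie on the edge \<open>e\<close>, so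
        \<open>smooth\<close> makes the same choice at each of them.\<close>
      then have "edge_of G x = e" if "x \<in> e" for x
        using that edge_of_eq[OF G] unfolding edges_def by blast
      then show "(\<forall>x\<in>e. g (smooth G A x) = g x) \<longleftrightarrow> (if e \<in> A then ?one e else ?zero e)"
        by (simp add: smooth_def)
    qed
    also have "\<dots> \<longleftrightarrow> (\<forall>e\<in>A. ?one e) \<and> (\<forall>e\<in>edges G - A. ?zero e)"
      using that by (meson DiffD1 DiffD2 DiffI subsetD)
    finally show ?thesis .
  qed
  show ?thesis
    unfolding edge_weight_def prod_diff_conv_sum[OF finite_edges[OF G]]
  proof (intro sum.cong refl)
    fix A assume A: "A \<in> Pow (edges G)"
    then have "finite A" "finite (edges G - A)"
      using finite_edges[OF G] by (auto intro: finite_subset)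
    then show "(-1) ^ card A * (\<Prod>e\<in>A. of_bool (?one e)) * (\<Prod>e\<in>edges G - A. of_bool (?zero e)) =
      ((-1) ^ card A * of_bool (\<forall>x\<in>flags G. g (smooth G A x) = g x) :: 'a)"
      using A smooth_iff[of A] by (simp add: prod_of_bool mult.assoc flip: of_bool_conj)
  qed
qed

text \<open>Exchanging the colours of the two corners at one end exchanges the two terms of the
  weight, so equal colours make the terms cancel.\<close>

lemma edge_weight_nonzero_cross:
  assumes "is_piece k G" "x \<in> flags G" "edge_weight G g (edge_of G x) \<noteq> (0::'a::comm_ring_1)"
  shows "g (cross G x) \<noteq> g x"
proof
  assume eq: "g (cross G x) = g x"
  note simps = is_piece_cross[OF assms(1)] is_piece_along[OF assms(1)] assms(2)
  have "(\<forall>y\<in>edge_of G x. g (along G y) = g y) \<longleftrightarrow>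
      (\<forall>y\<in>edge_of G x. g (along G (cross G y)) = g y)"
    by (auto simp: edge_of_def simps eq)
  then show False
    using assms(3) by (simp add: edge_weight_def)
qed

lemma prod_edge_weight_nonzero:
  assumes "is_piece k G" "(\<Prod>e\<in>edges G. edge_weight G g e) \<noteq> (0::'a::comm_ring_1)" "x \<in> flags G"
  shows "edge_weight G g (edge_of G x) \<noteq> (0::'a)"
proof
  assume "edge_weight G g (edge_of G x) = (0::'a)"
  moreover have "edge_of G x \<in> edges G" using assms(3) by (simp add: edges_def)
  ultimately show False
    using assms(2) prod_zero[OF finite_edges[OF assms(1)]] by metis
qed

section \<open>The Penrose and BM polynomials as sums over colourings\<close>

lemma ball_graphs:
  "(\<forall>(x, y)\<in>(\<lambda>x. (x, f x)) ` F \<union> (\<lambda>x. (x, h x)) ` F. g x = g y) \<longleftrightarrow>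
   (\<forall>x\<in>F. g (f x) = g x) \<and> (\<forall>x\<in>F. g (h x) = g x)"
  by (simp add: ball_Un eq_commute)

text \<open>Each power of \<open>n\<close> counts the colourings constant along arcs and smoothed
  strands; exchanging the sums over smoothings and over colourings leaves products of edge
  weights.\<close>

lemma poly_penrose:
  assumes G: "is_piece 0 G"
  shows "poly (penrose G) (of_nat n) =
    (\<Sum>g\<in>colourings 0 n G. \<Prod>e\<in>edges G. edge_weight G g e :: 'a::comm_ring_1)"
proof -
  let ?S = "flags G \<union> discs G"
  let ?R = "\<lambda>A. (\<lambda>x. (x, arc G x)) ` flags G \<union> (\<lambda>x. (x, smooth G A x)) ` flags G"
  have S: "finite ?S" using G by (simp add: is_piece_def)
  have R: "?R A \<subseteq> ?S \<times> ?S" for A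
    using is_piece_cross[OF G] is_piece_along(1)[OF G] is_piece_arc[OF G]
    by (auto simp: smooth_def)
  have "{g \<in> ?S \<rightarrow>\<^sub>E {..<n}. \<forall>(x, y)\<in>?R A. g x = g y} =
      {g \<in> colourings 0 n G. \<forall>x\<in>flags G. g (smooth G A x) = g x}" for A
    unfolding ball_graphs by (auto simp: colourings_def)
  then have "poly (penrose G) (of_nat n) =
    (\<Sum>A\<in>Pow (edges G). (-1) ^ card A *
       of_nat (card {g \<in> colourings 0 n G. \<forall>x\<in>flags G. g (smooth G A x) = g x}) :: 'a)"
    unfolding penrose_def poly_sum circles_def
    by (intro sum.cong refl)
       (simp add: poly_monom power_card_components[OF S R] flip: of_nat_power)
  also have "\<dots> = (\<Sum>A\<in>Pow (edges G). \<Sum>g\<in>colourings 0 n G.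
      (-1) ^ card A * of_bool (\<forall>x\<in>flags G. g (smooth G A x) = g x))"
    by (simp add: of_nat_card_filter[OF finite_colourings_piece[OF G]] sum_distrib_left)
  also have "\<dots> = (\<Sum>g\<in>colourings 0 n G. \<Prod>e\<in>edges G. edge_weight G g e)"
    by (subst sum.swap) (simp add: prod_edge_weight[OF G])
  finally show ?thesis .
qed

text \<open>
  The buckles on the edges do not restrict the sum further, because the weight of a monochromatic
  edge vanishes: its two smoothings cancel.
\<close>

lemma poly_bm_polynomial:
  assumes G: "is_piece 0 G" and M: "finite M" "\<And>m. m \<in> M \<Longrightarrow> \<Union>m \<subseteq> flags G"
  shows "poly (bm_polynomial G M) (of_nat n) =
    (\<Sum>g | g \<in> colourings 0 n G \<and> (\<forall>m\<in>M. \<not> monochrome g (\<Union>m)).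
      \<Prod>e\<in>edges G. edge_weight G g e :: 'a::comm_ring_1)"
proof -
  let ?S = "flags G \<union> discs G"
  let ?R = "\<lambda>A. (\<lambda>x. (x, arc G x)) ` flags G \<union> (\<lambda>x. (x, smooth G A x)) ` flags G"
  let ?pts = "\<lambda>b. case b of Inl e \<Rightarrow> e | Inr m \<Rightarrow> \<Union>m"
  let ?B = "edges G <+> M"
  let ?Q = "\<lambda>g :: 'b \<Rightarrow> nat. \<forall>b\<in>?B. \<not> monochrome g (?pts b)"
  have S: "finite ?S" using G by (simp add: is_piece_def)
  have B: "finite ?B" using finite_edges[OF G] M(1) by simp
  have R: "?R A \<subseteq> ?S \<times> ?S" for A
    using is_piece_cross[OF G] is_piece_along(1)[OF G] is_piece_arc[OF G]
    by (auto simp: smooth_def)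
  have pts: "?pts b \<subseteq> ?S" if "b \<in> ?B" for b
    using that edges_subset[OF G] M(2) by fastforce
  have eq: "{g \<in> ?S \<rightarrow>\<^sub>E {..<n}. (\<forall>(x, y)\<in>?R A. g x = g y) \<and> ?Q g} =
      {g \<in> {g \<in> colourings 0 n G. ?Q g}. \<forall>x\<in>flags G. g (smooth G A x) = g x}" for A
    unfolding ball_graphs by (auto simp: colourings_def)
  have fin: "finite {g \<in> colourings 0 n G. ?Q g}"
    using finite_colourings_piece[OF G] by simp
  have "poly (bm_polynomial G M) (of_nat n) =
    (\<Sum>A\<in>Pow (edges G). (-1) ^ card A *
       of_nat (card {g \<in> {g \<in> colourings 0 n G. ?Q g}. \<forall>x\<in>flags G. g (smooth G A x) = g x}) :: 'a)"
    unfolding bm_polynomial_def poly_sum circles_def eq[symmetric]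
    by (intro sum.cong refl) (simp add: poly_buckle_bracket[OF S R B pts])
  also have "\<dots> = (\<Sum>A\<in>Pow (edges G). \<Sum>g | g \<in> colourings 0 n G \<and> ?Q g.
      (-1) ^ card A * of_bool (\<forall>x\<in>flags G. g (smooth G A x) = g x))"
    by (simp only: of_nat_card_filter[OF fin] sum_distrib_left)
  also have "\<dots> = (\<Sum>g | g \<in> colourings 0 n G \<and> ?Q g. \<Prod>e\<in>edges G. edge_weight G g e)"
    by (subst sum.swap) (simp only: prod_edge_weight[OF G])
  also have "\<dots> = (\<Sum>g | g \<in> colourings 0 n G \<and> (\<forall>m\<in>M. \<not> monochrome g (\<Union>m)).
      \<Prod>e\<in>edges G. edge_weight G g e)"
  proof (rule sum.mono_neutral_left)
    show "\<forall>g\<in>{g \<in> colourings 0 n G. \<forall>m\<in>M. \<not> monochrome g (\<Union>m)} - {g \<in> colourings 0 n G. ?Q g}.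
      (\<Prod>e\<in>edges G. edge_weight G g e) = (0::'a)"
    proof (intro ballI, rule ccontr)
      fix g
      assume g: "g \<in> {g \<in> colourings 0 n G. \<forall>m\<in>M. \<not> monochrome g (\<Union>m)} - {g \<in> colourings 0 n G. ?Q g}"
        and nz: "(\<Prod>e\<in>edges G. edge_weight G g e) \<noteq> (0::'a)"
      \<comment> \<open>A colouring in the difference respects the buckles in \<open>M\<close>, so
        it must violate the one on some edge.\<close>
      from g obtain e where "e \<in> edges G" "monochrome g e"
        unfolding Plus_def by fastforce
      then obtain x where x: "x \<in> flags G" "monochrome g (edge_of G x)"
        unfolding edges_def by blast
      then have "g (cross G x) = g x"
        unfolding monochrome_def edge_of_def by blast
      then show False
        using edge_weight_nonzero_cross[OF G x(1) prod_edge_weight_nonzero[OF G nz x(1)]] by simp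
    qed
    show "finite {g \<in> colourings 0 n G. \<forall>m\<in>M. \<not> monochrome g (\<Union>m)}"
      using finite_colourings_piece[OF G] by simp
    show "{g \<in> colourings 0 n G. ?Q g} \<subseteq> {g \<in> colourings 0 n G. \<forall>m\<in>M. \<not> monochrome g (\<Union>m)}"
    proof safe
      fix g m assume Q: "?Q g" and "m \<in> M" "monochrome g (\<Union>m)"
      then show False using bspec[OF Q, of "Inr m"] by auto
    qed
  qed
  finally show ?thesis .
qed

section \<open>Colourings of the strand ends with a given kernel\<close>

text \<open>Two points of the same colour are split off at a time, which preserves all parities. The
  pairs become the arcs of a cap.\<close>

lemma ex_monochrome_pairing:
  assumes "finite S" "\<And>c. even (card {x \<in> S. g x = c})"
  shows "\<exists>M. partition_on S M \<and> (\<forall>m\<in>M. card m = 2 \<and> monochrome g m)"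
  using assms
proof (induction S rule: finite_psubset_induct)
  case (psubset S)
  show ?case
  proof (cases "S = {}")
    case True
    then show ?thesis by (auto simp: partition_on_empty)
  next
    case False
    then obtain x where x: "x \<in> S" by blast
    \<comment> \<open>The colour class of \<open>x\<close> has even size, so it offers a partner for
      \<open>x\<close>.\<close>
    have "{z \<in> S. g z = g x} \<noteq> {x}"
    proof
      assume "{z \<in> S. g z = g x} = {x}"
      then show False using psubset.prems[of "g x"] by simp
    qed
    then obtain y where y: "y \<in> S" "g y = g x" "y \<noteq> x"
      using x by blast
    have "even (card {z \<in> S - {x, y}. g z = c})" for c
    proof (cases "c = g x")
      case True
      have "{z \<in> S - {x, y}. g z = c} = {z \<in> S. g z = c} - {x, y}" by blast
      moreover have "card ({z \<in> S. g z = c} - {x, y}) = card {z \<in> S. g z = c} - card {x, y}"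
        by (rule card_Diff_subset) (use x y True in auto)
      ultimately show ?thesis
        using y psubset.prems[of c] by simp
    next
      case False
      then have "{z \<in> S - {x, y}. g z = c} = {z \<in> S. g z = c}" using y by auto
      then show ?thesis using psubset.prems[of c] by simp
    qed
    then obtain M where M: "partition_on (S - {x, y}) M" "\<forall>m\<in>M. card m = 2 \<and> monochrome g m"
      using psubset.IH[of "S - {x, y}"] x by blast
    have "disjnt {x, y} (\<Union>M)"
      using partition_onD1[OF M(1)] by (auto simp: disjnt_def)
    then have "partition_on S (insert {x, y} M)"
      using M(1) x y by (simp add: partition_on_insert)
    moreover have "card {x, y} = 2" "monochrome g {x, y}"
      using y by (auto simp: monochrome_def)
    ultimately show ?thesis using M(2) by blast
  qed
qed

lemma even_card_fpf_involution_on: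
  assumes "finite S" "fpf_involution_on S f"
  shows "even (card S)"
  using assms
proof (induction S rule: finite_psubset_induct)
  case (psubset S)
  show ?case
  proof (cases "S = {}")
    case False
    then obtain x where x: "x \<in> S" by blast
    then have fx: "f x \<in> S" "f x \<noteq> x" "f (f x) = x"
      using psubset.prems by (auto simp: fpf_involution_on_def)
    have "f y \<noteq> x" "f y \<noteq> f x" if "y \<in> S - {x, f x}" for y
      using that fx psubset.prems unfolding fpf_involution_on_def by (metis DiffE insertCI)+
    then have "fpf_involution_on (S - {x, f x}) f"
      using psubset.prems by (auto simp: fpf_involution_on_def)
    then have "even (card (S - {x, f x}))"
      using psubset.IH[of "S - {x, f x}"] x by blast
    moreover have "card S = card (S - {x, f x}) + card {x, f x}"
      using card_mono[OF psubset.hyps, of "{x, f x}"] x fx(1) by (subst card_Diff_subset) auto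
    ultimately show ?thesis using fx by simp
  qed simp
qed

text \<open>The pairs that a member of \<open>caps\<close> with arcs \<open>M\<close> is allowed to
  mark.\<close>

definition buckle_sites :: "(nat \<times> bool) set set \<Rightarrow> (nat \<times> bool) set set set" where
  "buckle_sites M = {{m, m'} |m m'. m \<in> M \<and> m' \<in> M \<and> m \<noteq> m' \<and> \<not> share_spoke m m'}"

definition same_kernel :: "'s set \<Rightarrow> ('s \<Rightarrow> 'c) \<Rightarrow> ('s \<Rightarrow> 'd) \<Rightarrow> bool" where
  "same_kernel S g h \<longleftrightarrow> (\<forall>x\<in>S. \<forall>y\<in>S. g x = g y \<longleftrightarrow> h x = h y)"

lemma finite_buckle_sites: "finite M \<Longrightarrow> finite (buckle_sites M)"
  by (rule finite_subset[of _ "Pow M"]) (auto simp: buckle_sites_def)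

lemma monochrome_Un_iff:
  assumes "monochrome g X" "monochrome g Y" "x \<in> X" "y \<in> Y"
  shows "monochrome g (X \<union> Y) \<longleftrightarrow> g x = g y"
proof
  assume "monochrome g (X \<union> Y)"
  then show "g x = g y" using assms(3,4) unfolding monochrome_def by blast
next
  assume xy: "g x = g y"
  have "g z = g x" if "z \<in> X \<union> Y" for z
  proof (cases "z \<in> X")
    case True
    then show ?thesis using assms(1,3) unfolding monochrome_def by blast
  next
    case False
    then have "g z = g y" using that assms(2,4) unfolding monochrome_def by blast
    then show ?thesis using xy by simp
  qed
  then show "monochrome g (X \<union> Y)" unfolding monochrome_def by metis
qed

text \<open>
  Colours on arcs that share a spoke are distinct by assumption; for all other pairs of arcs the
  kernel can be read off from the monochromatic buckle sites.
\<close>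

lemma same_kernel_iff_buckle_sites:
  assumes M: "partition_on (strand_ends k) M"
    and g: "\<And>m. m \<in> M \<Longrightarrow> monochrome g m" "\<And>j b. j < k \<Longrightarrow> g (j, b) \<noteq> g (j, \<not> b)"
    and h: "\<And>m. m \<in> M \<Longrightarrow> monochrome h m" "\<And>j b. j < k \<Longrightarrow> h (j, b) \<noteq> h (j, \<not> b)"
  shows "same_kernel (strand_ends k) g h \<longleftrightarrow>
    (\<forall>q\<in>buckle_sites M. monochrome g (\<Union>q) \<longleftrightarrow> monochrome h (\<Union>q))"
proof
  assume K: "same_kernel (strand_ends k) g h"
  show "\<forall>q\<in>buckle_sites M. monochrome g (\<Union>q) \<longleftrightarrow> monochrome h (\<Union>q)"
  proof
    fix q assume "q \<in> buckle_sites M"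
    then have "\<Union>q \<subseteq> strand_ends k"
      using partition_onD1[OF M] by (auto simp: buckle_sites_def)
    then show "monochrome g (\<Union>q) \<longleftrightarrow> monochrome h (\<Union>q)"
      using K unfolding same_kernel_def monochrome_def by blast
  qed
next
  assume sites: "\<forall>q\<in>buckle_sites M. monochrome g (\<Union>q) \<longleftrightarrow> monochrome h (\<Union>q)"
  show "same_kernel (strand_ends k) g h"
    unfolding same_kernel_def
  proof (intro ballI)
    fix x y assume xy: "x \<in> strand_ends k" "y \<in> strand_ends k"
    then obtain m m' where m: "m \<in> M" "x \<in> m" "m' \<in> M" "y \<in> m'"
      using partition_onD1[OF M] by blast
    have union: "monochrome u (\<Union>{m, m'}) \<longleftrightarrow> u x = u y"
      if "monochrome u m" "monochrome u m'" for u :: "nat \<times> bool \<Rightarrow> 'z"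
      using monochrome_Un_iff[OF that m(2,4)] by simp
    consider "m = m'" | "m \<noteq> m'" "share_spoke m m'" | "{m, m'} \<in> buckle_sites M"
      using m unfolding buckle_sites_def by blast
    then show "g x = g y \<longleftrightarrow> h x = h y"
    proof cases
      case 1
      then show ?thesis using m g(1)[OF m(1)] h(1)[OF m(1)] unfolding monochrome_def by blast
    next
      case 2
      then obtain j b where jb: "(j, b) \<in> m" "(j, \<not> b) \<in> m'" by (auto simp: share_spoke_def)
      then have j: "j < k"
        using partition_onD1[OF M] m(1) by (auto simp: strand_ends_def)
      have "g (j, b) = g x" "g (j, \<not> b) = g y" "h (j, b) = h x" "h (j, \<not> b) = h y"
        using g(1)[OF m(1)] g(1)[OF m(3)] h(1)[OF m(1)] h(1)[OF m(3)] jb m(2,4)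
        unfolding monochrome_def by blast+
      \<comment> \<open>Both colourings separate the two strand ends of spoke \<open>j\<close>, so
        both equalities fail.\<close>
      then show ?thesis using g(2)[OF j, of b] h(2)[OF j, of b] by simp
    next
      case 3
      with sites have "monochrome g (\<Union>{m, m'}) \<longleftrightarrow> monochrome h (\<Union>{m, m'})" by blast
      then show ?thesis using union[OF g(1) g(1)] union[OF h(1) h(1)] m(1,3) by blast
    qed
  qed
qed

section \<open>Cancellation over the colourings with a fixed kernel\<close>

definition cap_colourings :: "nat \<Rightarrow> nat \<Rightarrow> cap \<Rightarrow> (nat \<times> bool \<Rightarrow> nat) set" where
  "cap_colourings k n Cap = {\<kappa> \<in> strand_ends k \<rightarrow>\<^sub>E {..<n}.
     (\<forall>m\<in>fst Cap. monochrome \<kappa> m) \<and> (\<forall>q\<in>snd Cap. \<not> monochrome \<kappa> (\<Union>q))}"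

text \<open>One colouring \<open>\<mu>\<close> with this kernel and nonzero value supplies a
  matching \<open>M\<close> of the strand ends. Relative to \<open>M\<close> the kernel is a list of
  equalities and inequalities at the buckle sites; inclusion-exclusion removes the equalities, and
  every resulting term is the sum belonging to one cap.\<close>

lemma sum_same_kernel_eq_0:
  fixes Z :: "(nat \<times> bool \<Rightarrow> nat) \<Rightarrow> 'a::comm_ring_1"
  assumes spoke: "\<And>\<kappa> j b. \<kappa> \<in> strand_ends k \<rightarrow>\<^sub>E {..<n} \<Longrightarrow> Z \<kappa> \<noteq> 0 \<Longrightarrow> j < k \<Longrightarrow> \<kappa> (j, b) \<noteq> \<kappa> (j, \<not> b)"
    and ev: "\<And>\<kappa> c. \<kappa> \<in> strand_ends k \<rightarrow>\<^sub>E {..<n} \<Longrightarrow> Z \<kappa> \<noteq> 0 \<Longrightarrow> even (card {p \<in> strand_ends k. \<kappa> p = c})"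
    and caps: "\<And>Cap. Cap \<in> caps k \<Longrightarrow> (\<Sum>\<kappa>\<in>cap_colourings k n Cap. Z \<kappa>) = 0"
    and \<kappa>0: "\<kappa>0 \<in> strand_ends k \<rightarrow>\<^sub>E {..<n}"
  shows "(\<Sum>\<kappa> | \<kappa> \<in> strand_ends k \<rightarrow>\<^sub>E {..<n} \<and> same_kernel (strand_ends k) \<kappa> \<kappa>0. Z \<kappa>) = 0"
proof (cases "\<exists>\<kappa>. \<kappa> \<in> strand_ends k \<rightarrow>\<^sub>E {..<n} \<and> same_kernel (strand_ends k) \<kappa> \<kappa>0 \<and> Z \<kappa> \<noteq> 0")
  case False
  then show ?thesis by (intro sum.neutral) blast
next
  case True
  let ?K = "strand_ends k \<rightarrow>\<^sub>E {..<n}"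
  from True obtain \<mu> where \<mu>: "\<mu> \<in> ?K" "same_kernel (strand_ends k) \<mu> \<kappa>0" "Z \<mu> \<noteq> 0"
    by blast
  obtain M where M: "partition_on (strand_ends k) M" "\<And>m. m \<in> M \<Longrightarrow> card m = 2"
      "\<And>m. m \<in> M \<Longrightarrow> monochrome \<mu> m"
    using ex_monochrome_pairing[OF finite_strand_ends ev[OF \<mu>(1,3)]] by blast
  have finM: "finite M"
    using partition_onD1[OF M(1)] finite_strand_ends[of k] finite_UnionD by metis
  have finK: "finite ?K"
    by (simp add: finite_PiE)
  \<comment> \<open>The sites in \<open>diff\<close> carry a buckle in every cap that is used; those
    in \<open>same\<close> carry one or not, depending on the term of the expansion.\<close>
  define same where "same = {q \<in> buckle_sites M. monochrome \<mu> (\<Union>q)}"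
  define diff where "diff = {q \<in> buckle_sites M. \<not> monochrome \<mu> (\<Union>q)}"
  let ?KM = "{\<kappa> \<in> ?K. (\<forall>m\<in>M. monochrome \<kappa> m) \<and> (\<forall>q\<in>diff. \<not> monochrome \<kappa> (\<Union>q))}"
  have finKM: "finite ?KM" using finK by simp
  have fin_same: "finite same"
    using finite_buckle_sites[OF finM] by (simp add: same_def)
  have cap: "(M, D \<union> diff) \<in> caps k" if "D \<subseteq> same" for D
    using that M by (auto simp: caps_def same_def diff_def buckle_sites_def)
  have kernel: "same_kernel (strand_ends k) \<kappa> \<mu> \<longleftrightarrow>
      (\<forall>m\<in>M. monochrome \<kappa> m) \<and> (\<forall>q\<in>diff. \<not> monochrome \<kappa> (\<Union>q)) \<and> (\<forall>q\<in>same. monochrome \<kappa> (\<Union>q))"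
    if "\<kappa> \<in> ?K" "Z \<kappa> \<noteq> 0" for \<kappa>
  proof -
    have mono: "monochrome \<kappa> m" if "same_kernel (strand_ends k) \<kappa> \<mu>" "m \<in> M" for m
    proof -
      have "m \<subseteq> strand_ends k" using partition_onD1[OF M(1)] that(2) by blast
      then show ?thesis
        using that(1) M(3)[OF that(2)] unfolding same_kernel_def monochrome_def by blast
    qed
    have "same_kernel (strand_ends k) \<kappa> \<mu> \<longleftrightarrow>
        (\<forall>q\<in>buckle_sites M. monochrome \<kappa> (\<Union>q) \<longleftrightarrow> monochrome \<mu> (\<Union>q))"
      if "\<And>m. m \<in> M \<Longrightarrow> monochrome \<kappa> m"
      using same_kernel_iff_buckle_sites[OF M(1) that spoke[OF \<open>\<kappa> \<in> ?K\<close> \<open>Z \<kappa> \<noteq> 0\<close>] M(3) spoke[OF \<mu>(1,3)]]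
      by blast
    then show ?thesis
      using mono unfolding same_def diff_def by blast
  qed
  have "(\<Sum>\<kappa> | \<kappa> \<in> ?K \<and> same_kernel (strand_ends k) \<kappa> \<kappa>0. Z \<kappa>) =
      (\<Sum>\<kappa> | \<kappa> \<in> ?K \<and> same_kernel (strand_ends k) \<kappa> \<mu>. Z \<kappa>)"
    by (intro sum.cong refl) (use \<mu>(2) in \<open>auto simp: same_kernel_def\<close>)
  \<comment> \<open>\<open>kernel\<close> relies on distinct colours at each spoke end and so is
    available where \<open>Z\<close> is nonzero; all other colourings contribute nothing on either
    side.\<close>
  also have "\<dots> = (\<Sum>\<kappa>\<in>?KM. Z \<kappa> * of_bool (\<forall>q\<in>same. monochrome \<kappa> (\<Union>q)))"
    unfolding of_bool_def mult.commute[of "Z _"] if_distrib[of "\<lambda>x. x * _"] mult_1 mult_zero_left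
    by (rule sum.mono_neutral_cong) (use finK kernel in auto)
  \<comment> \<open>Each equality at a site in \<open>same\<close> is 1 minus an inequality;
    \<open>D\<close> is the set of sites at which the inequality is chosen.\<close>
  also have "\<dots> = (\<Sum>\<kappa>\<in>?KM. Z \<kappa> *
      (\<Sum>D\<in>Pow same. (-1) ^ card D * of_bool (\<forall>q\<in>D. \<not> monochrome \<kappa> (\<Union>q))))"
    by (subst sum_alternating_of_bool[OF fin_same]) simp
  also have "\<dots> = (\<Sum>D\<in>Pow same. \<Sum>\<kappa>\<in>?KM.
      Z \<kappa> * ((-1) ^ card D * of_bool (\<forall>q\<in>D. \<not> monochrome \<kappa> (\<Union>q))))"
    unfolding sum_distrib_left by (rule sum.swap)
  also have "\<dots> = (\<Sum>D\<in>Pow same. 0)"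
  proof (intro sum.cong refl)
    fix D assume "D \<in> Pow same"
    \<comment> \<open>Requiring the sites in \<open>D\<close> to differ, besides those in
      \<open>diff\<close>, is the condition imposed by the buckles of the cap
      \<open>(M, D \<union> diff)\<close>.\<close>
    have "(\<Sum>\<kappa>\<in>?KM. Z \<kappa> * of_bool (\<forall>q\<in>D. \<not> monochrome \<kappa> (\<Union>q))) =
        (\<Sum>\<kappa>\<in>cap_colourings k n (M, D \<union> diff). Z \<kappa>)"
      by (rule sum.mono_neutral_cong_right) (use finKM in \<open>auto simp: cap_colourings_def\<close>)
    also have "\<dots> = 0"
      using caps[OF cap] \<open>D \<in> Pow same\<close> by blast
    finally have "(-1) ^ card D * (\<Sum>\<kappa>\<in>?KM. Z \<kappa> * of_bool (\<forall>q\<in>D. \<not> monochrome \<kappa> (\<Union>q))) = 0"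
      by simp
    then show "(\<Sum>\<kappa>\<in>?KM. Z \<kappa> * ((-1) ^ card D * of_bool (\<forall>q\<in>D. \<not> monochrome \<kappa> (\<Union>q)))) = 0"
      unfolding sum_distrib_left by (simp only: mult.left_commute)
  qed
  finally show ?thesis by simp
qed

text \<open>The colourings are split by kernel; on each class \<open>f\<close> is a constant that
  can be pulled out of a vanishing sum.\<close>

lemma sum_kernel_invariant_eq_0:
  fixes Z :: "(nat \<times> bool \<Rightarrow> nat) \<Rightarrow> 'a::comm_ring_1"
  assumes spoke: "\<And>\<kappa> j b. \<kappa> \<in> strand_ends k \<rightarrow>\<^sub>E {..<n} \<Longrightarrow> Z \<kappa> \<noteq> 0 \<Longrightarrow> j < k \<Longrightarrow> \<kappa> (j, b) \<noteq> \<kappa> (j, \<not> b)"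
    and ev: "\<And>\<kappa> c. \<kappa> \<in> strand_ends k \<rightarrow>\<^sub>E {..<n} \<Longrightarrow> Z \<kappa> \<noteq> 0 \<Longrightarrow> even (card {p \<in> strand_ends k. \<kappa> p = c})"
    and caps: "\<And>Cap. Cap \<in> caps k \<Longrightarrow> (\<Sum>\<kappa>\<in>cap_colourings k n Cap. Z \<kappa>) = 0"
    and f: "\<And>\<kappa> \<mu>. \<kappa> \<in> strand_ends k \<rightarrow>\<^sub>E {..<n} \<Longrightarrow> \<mu> \<in> strand_ends k \<rightarrow>\<^sub>E {..<n} \<Longrightarrow>
      same_kernel (strand_ends k) \<kappa> \<mu> \<Longrightarrow> f \<kappa> = f \<mu>"
  shows "(\<Sum>\<kappa>\<in>strand_ends k \<rightarrow>\<^sub>E {..<n}. f \<kappa> * Z \<kappa>) = 0"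
proof -
  let ?K = "strand_ends k \<rightarrow>\<^sub>E {..<n}"
  let ?cls = "\<lambda>\<kappa>. {\<mu> \<in> ?K. same_kernel (strand_ends k) \<mu> \<kappa>}"
  have finK: "finite ?K"
    by (simp add: finite_PiE)
  have cls_eq: "?cls \<kappa> = ?cls \<mu> \<longleftrightarrow> same_kernel (strand_ends k) \<kappa> \<mu>" if "\<kappa> \<in> ?K" "\<mu> \<in> ?K" for \<kappa> \<mu>
  proof
    assume "?cls \<kappa> = ?cls \<mu>"
    moreover have "\<kappa> \<in> ?cls \<kappa>" using that by (simp add: same_kernel_def)
    ultimately show "same_kernel (strand_ends k) \<kappa> \<mu>" by blast
  next
    assume "same_kernel (strand_ends k) \<kappa> \<mu>"
    then show "?cls \<kappa> = ?cls \<mu>" by (auto simp: same_kernel_def)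
  qed
  have "(\<Sum>\<kappa>\<in>?K. f \<kappa> * Z \<kappa>) = (\<Sum>c\<in>?cls ` ?K. \<Sum>\<mu> | \<mu> \<in> ?K \<and> ?cls \<mu> = c. f \<mu> * Z \<mu>)"
    by (rule sum.image_gen[OF finK])
  also have "\<dots> = 0"
  proof (rule sum.neutral, rule ballI)
    fix c assume "c \<in> ?cls ` ?K"
    then obtain \<kappa> where \<kappa>: "\<kappa> \<in> ?K" "c = ?cls \<kappa>" by blast
    have "(\<Sum>\<mu> | \<mu> \<in> ?K \<and> ?cls \<mu> = c. f \<mu> * Z \<mu>) =
        (\<Sum>\<mu> | \<mu> \<in> ?K \<and> same_kernel (strand_ends k) \<mu> \<kappa>. f \<kappa> * Z \<mu>)"
    proof (rule sum.cong)
      show "{\<mu> \<in> ?K. ?cls \<mu> = c} = {\<mu> \<in> ?K. same_kernel (strand_ends k) \<mu> \<kappa>}"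
        unfolding \<kappa>(2) using cls_eq[OF _ \<kappa>(1)] by blast
      fix \<mu> assume "\<mu> \<in> {\<mu> \<in> ?K. same_kernel (strand_ends k) \<mu> \<kappa>}"
      then have "f \<mu> = f \<kappa>" using f[OF _ \<kappa>(1), of \<mu>] by blast
      then show "f \<mu> * Z \<mu> = f \<kappa> * Z \<mu>" by simp
    qed
    also have "\<dots> = f \<kappa> * (\<Sum>\<mu> | \<mu> \<in> ?K \<and> same_kernel (strand_ends k) \<mu> \<kappa>. Z \<mu>)"
      by (rule sum_distrib_left[symmetric])
    also have "(\<Sum>\<mu> | \<mu> \<in> ?K \<and> same_kernel (strand_ends k) \<mu> \<kappa>. Z \<mu>) = 0"
      by (rule sum_same_kernel_eq_0[OF spoke ev caps \<kappa>(1)])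
    finally show "(\<Sum>\<mu> | \<mu> \<in> ?K \<and> ?cls \<mu> = c. f \<mu> * Z \<mu>) = 0" by simp
  qed
  finally show ?thesis .
qed

section \<open>Capped configurations\<close>

definition boundary :: "nat \<Rightarrow> 'f piece \<Rightarrow> ('f \<Rightarrow> nat) \<Rightarrow> nat \<times> bool \<Rightarrow> nat" where
  "boundary k G g = (\<lambda>p\<in>strand_ends k. g (strand G p))"

lemma boundary_in_PiE:
  assumes "is_piece k G" "g \<in> colourings k n G"
  shows "boundary k G g \<in> strand_ends k \<rightarrow>\<^sub>E {..<n}"
  using assms(2) is_piece_strand(1)[OF assms(1)]
  by (auto simp: boundary_def colourings_def PiE_def Pi_def)

text \<open>The two corners at a spoke end are exchanged by \<open>cross\<close>, so a nonzero
  weight of the spoke separates their colours.\<close>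

lemma boundary_spoke:
  assumes G: "is_piece k G" and nz: "(\<Prod>e\<in>edges G. edge_weight G g e) \<noteq> (0::'a::comm_ring_1)"
    and "j < k"
  shows "boundary k G g (j, b) \<noteq> boundary k G g (j, \<not> b)"
proof -
  have p: "(j, b) \<in> strand_ends k" using \<open>j < k\<close> by (simp add: strand_ends_def)
  note s = is_piece_strand[OF G p]
  show ?thesis
    using edge_weight_nonzero_cross[OF G s(1) prod_edge_weight_nonzero[OF G nz s(1)]] s p
    by (simp add: boundary_def)
qed

text \<open>
  If the weight does not vanish, the colouring is constant along the strands of some smoothing,
  so that its colour classes are unions of pairs of flags; the arcs pair up the flags off the
  circle as well.
\<close>

lemma boundary_even:
  assumes G: "is_piece k G" and g: "g \<in> colourings k n G"
    and nz: "(\<Prod>e\<in>edges G. edge_weight G g e) \<noteq> (0::'a::comm_ring_1)"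
  shows "even (card {p \<in> strand_ends k. boundary k G g p = c})"
proof -
  let ?T = "strand G ` strand_ends k"
  have fin: "finite (flags G)" using G by (simp add: is_piece_def)
  have "\<exists>A\<in>Pow (edges G). (-1) ^ card A *
      of_bool (\<forall>x\<in>flags G. g (smooth G A x) = g x) \<noteq> (0::'a)"
    using nz unfolding prod_edge_weight[OF G] by (meson sum.neutral)
  then obtain A where A: "\<And>x. x \<in> flags G \<Longrightarrow> g (smooth G A x) = g x"
    by (auto simp: of_bool_def split: if_splits)
  have "fpf_involution_on {x \<in> flags G. g x = c} (smooth G A)"
    unfolding fpf_involution_on_def
  proof (intro ballI conjI)
    fix x assume "x \<in> {x \<in> flags G. g x = c}"
    then have x: "x \<in> flags G" "g x = c" by auto
    note cr = is_piece_cross[OF G] and al = is_piece_along[OF G]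
    have "smooth G A x \<in> edge_of G x"
      by (simp add: smooth_def edge_of_def)
    then have eq: "edge_of G (smooth G A x) = edge_of G x"
      by (rule edge_of_eq[OF G x(1)])
    show "smooth G A x \<in> {x \<in> flags G. g x = c}"
      using A[OF x(1)] x cr al(1) by (simp add: smooth_def)
    \<comment> \<open>Otherwise applying \<open>along\<close> once more would give
      \<open>cross G x = along G x\<close>, which is excluded for a ribbon.\<close>
    have "along G (cross G x) \<noteq> x"
      using al(4)[OF x(1)] al(3)[OF cr(1)[OF x(1)]] by metis
    then show "smooth G A x \<noteq> x"
      using al(2)[OF x(1)] by (simp add: smooth_def)
    \<comment> \<open>\<open>x\<close> and its image lie on the same edge, so the same smoothing is
      used twice, and \<open>along\<close> and \<open>cross\<close> are commuting
      involutions.\<close>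
    show "smooth G A (smooth G A x) = x"
      unfolding smooth_def[of G A "smooth G A x"] eq
      using al[OF x(1)] al[OF al(1)[OF x(1)]] al[OF cr(1)[OF x(1)]] cr[OF x(1)] cr[OF al(1)[OF x(1)]]
      by (simp add: smooth_def)
  qed
  then have "even (card {x \<in> flags G. g x = c})"
    by (rule even_card_fpf_involution_on[rotated]) (use fin in simp)
  moreover have "fpf_involution_on {x \<in> flags G - ?T. g x = c} (arc G)"
    using is_piece_arc[OF G] g by (auto simp: fpf_involution_on_def colourings_def)
  then have "even (card {x \<in> flags G - ?T. g x = c})"
    by (rule even_card_fpf_involution_on[rotated]) (use fin in simp)
  \<comment> \<open>The corners of colour \<open>c\<close> on the circle are what remains of an even
    set after an even subset is taken away.\<close>
  moreover have "{x \<in> flags G. g x = c} = {x \<in> flags G - ?T. g x = c} \<union> {x \<in> ?T. g x = c}"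
    using is_piece_strand(1)[OF G] by auto
  then have "card {x \<in> flags G. g x = c} = card {x \<in> flags G - ?T. g x = c} + card {x \<in> ?T. g x = c}"
    using fin by (subst card_Un_disjoint[symmetric]) auto
  ultimately have "even (card {x \<in> ?T. g x = c})" by simp
  moreover have "{x \<in> ?T. g x = c} = strand G ` {p \<in> strand_ends k. boundary k G g p = c}"
    by (auto simp: boundary_def)
  moreover have "inj_on (strand G) {p \<in> strand_ends k. boundary k G g p = c}"
    using G by (auto simp: is_piece_def intro: inj_on_subset)
  ultimately show ?thesis by (simp add: card_image)
qed

section \<open>Closing a configuration with a cap\<close>

lemma caps_partner:
  assumes "Cap \<in> caps k" "p \<in> strand_ends k"
  obtains p' where "{p, p'} \<in> fst Cap" "p' \<noteq> p" "p' \<in> strand_ends k"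
proof -
  have M: "partition_on (strand_ends k) (fst Cap)" "\<forall>m\<in>fst Cap. card m = 2"
    using assms(1) by (auto simp: caps_def)
  then obtain m where m: "m \<in> fst Cap" "p \<in> m"
    using assms(2) partition_onD1 by blast
  then obtain p' where "m = {p, p'}" "p' \<noteq> p"
    using M(2) by (metis card_2_iff insertE insert_commute singletonD)
  then show ?thesis using that m partition_onD1[OF M(1)] by blast
qed

text \<open>Disjointness of the arcs and injectivity of \<open>strand C\<close> leave a single
  candidate for the description in \<open>close_up\<close>.\<close>

lemma arc_close_up_strand:
  assumes C: "is_piece k C" and Cap: "Cap \<in> caps k" and p: "{p, p'} \<in> fst Cap"
  shows "arc (close_up k C Cap) (strand C p) = strand C p'"
proof -
  have M: "partition_on (strand_ends k) (fst Cap)"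
    using Cap by (auto simp: caps_def)
  have ends: "p \<in> strand_ends k" "p' \<in> strand_ends k"
    using partition_onD1[OF M] p by blast+
  have inj: "inj_on (strand C) (strand_ends k)"
    using C by (simp add: is_piece_def)
  have "(THE y. {strand C p, y} \<in> (\<lambda>m. strand C ` m) ` fst Cap) = strand C p'"
  proof (rule the_equality)
    show "{strand C p, strand C p'} \<in> (\<lambda>m. strand C ` m) ` fst Cap"
      using p by (intro image_eqI[of _ _ "{p, p'}"]) auto
    fix y assume "{strand C p, y} \<in> (\<lambda>m. strand C ` m) ` fst Cap"
    then obtain m where m: "m \<in> fst Cap" "{strand C p, y} = strand C ` m" by auto
    then have "m \<subseteq> strand_ends k" using partition_onD1[OF M] by blast
    then have "p \<in> m"
      using inj_on_image_mem_iff[OF inj ends(1)] m(2) by (metis insertI1)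
    then have "m = {p, p'}"
      using disjointD[OF partition_onD2[OF M] m(1) p] by blast
    then show "y = strand C p'"
      using m(2) by (auto simp: doubleton_eq_iff)
  qed
  then show ?thesis using ends by (simp add: close_up_def)
qed

lemma close_up_simps [simp]:
  "flags (close_up k C Cap) = flags C" "discs (close_up k C Cap) = discs C"
  "cross (close_up k C Cap) = cross C" "along (close_up k C Cap) = along C"
  "edges (close_up k C Cap) = edges C" "edge_weight (close_up k C Cap) g e = edge_weight C g e"
  by (simp_all add: close_up_def edges_def edge_of_def [abs_def] edge_weight_def)

lemma arc_close_up [simp]:
  "x \<notin> strand C ` strand_ends k \<Longrightarrow> arc (close_up k C Cap) x = arc C x"
  by (simp add: close_up_def)

lemma is_piece_close_up:
  assumes C: "is_piece k C" and Cap: "Cap \<in> caps k"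
  shows "is_piece 0 (close_up k C Cap)"
proof -
  let ?a = "arc (close_up k C Cap)"
  have "?a x \<in> flags C \<and> ?a x \<noteq> x \<and> ?a (?a x) = x" if x: "x \<in> flags C" for x
  proof (cases "x \<in> strand C ` strand_ends k")
    case True
    then obtain p where p: "p \<in> strand_ends k" "x = strand C p" by blast
    obtain p' where p': "{p, p'} \<in> fst Cap" "p' \<noteq> p" "p' \<in> strand_ends k"
      using caps_partner[OF Cap p(1)] .
    have "{p', p} \<in> fst Cap" using p'(1) by (simp add: insert_commute)
    moreover have "strand C p' \<noteq> strand C p"
      using C p p' by (auto simp: is_piece_def inj_on_eq_iff)
    ultimately show ?thesis
      using arc_close_up_strand[OF C Cap] p p' is_piece_strand(1)[OF C] by simp
  next
    case False
    then show ?thesis using is_piece_arc[OF C x] by simp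
  qed
  then show ?thesis
    using C by (simp add: is_piece_def fpf_involution_on_def)
qed

text \<open>The cap adds conditions only at the corners on the circle, and these can be read on the
  boundary colouring.\<close>

lemma colourings_close_up:
  assumes C: "is_piece k C" and Cap: "Cap \<in> caps k"
  shows "colourings 0 n (close_up k C Cap) =
    {g \<in> colourings k n C. \<forall>m\<in>fst Cap. monochrome (boundary k C g) m}"
proof -
  let ?a = "arc (close_up k C Cap)"
  let ?T = "strand C ` strand_ends k"
  have M: "partition_on (strand_ends k) (fst Cap)"
    using Cap by (auto simp: caps_def)
  have "(\<forall>x\<in>?T. g (?a x) = g x) \<longleftrightarrow> (\<forall>m\<in>fst Cap. monochrome (boundary k C g) m)" for g
  proof (intro iffI ballI)
    fix m assume g: "\<forall>x\<in>?T. g (?a x) = g x" and m: "m \<in> fst Cap"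
    have "m \<noteq> {}"
      using m partition_onD3[OF M] by blast
    then obtain p where "p \<in> m" by blast
    then have p: "p \<in> strand_ends k"
      using m partition_onD1[OF M] by blast
    obtain p' where p': "{p, p'} \<in> fst Cap" "p' \<noteq> p" "p' \<in> strand_ends k"
      using caps_partner[OF Cap p] .
    then have "m = {p, p'}"
      using disjointD[OF partition_onD2[OF M] m p'(1)] \<open>p \<in> m\<close> by blast
    moreover have "g (strand C p') = g (strand C p)"
      using bspec[OF g, of "strand C p"] p unfolding arc_close_up_strand[OF C Cap p'(1)] by blast
    ultimately show "monochrome (boundary k C g) m"
      using p'(3) p by (simp add: monochrome_def boundary_def)
  next
    fix x assume g: "\<forall>m\<in>fst Cap. monochrome (boundary k C g) m" and x: "x \<in> ?T"
    from x obtain p where p: "p \<in> strand_ends k" "x = strand C p" by blast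
    obtain p' where p': "{p, p'} \<in> fst Cap" "p' \<noteq> p" "p' \<in> strand_ends k"
      using caps_partner[OF Cap p(1)] .
    have "boundary k C g p' = boundary k C g p"
      using bspec[OF g p'(1)] unfolding monochrome_def by blast
    then show "g (?a x) = g x"
      using p p' arc_close_up_strand[OF C Cap p'(1)] by (simp add: boundary_def)
  qed
  moreover have "(\<forall>x\<in>flags C. g (?a x) = g x) \<longleftrightarrow>
      (\<forall>x\<in>flags C - ?T. g (arc C x) = g x) \<and> (\<forall>x\<in>?T. g (?a x) = g x)" for g :: "_ \<Rightarrow> nat"
  proof -
    have "?T \<subseteq> flags C" using is_piece_strand(1)[OF C] by blast
    then have "flags C - ?T \<union> ?T = flags C" by blast
    then have "(\<forall>x\<in>flags C. P x) \<longleftrightarrow> (\<forall>x\<in>flags C - ?T. P x) \<and> (\<forall>x\<in>?T. P x)" for P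
      using ball_Un[of "flags C - ?T" ?T P] by argo
    then have "(\<forall>x\<in>flags C. g (?a x) = g x) \<longleftrightarrow>
      (\<forall>x\<in>flags C - ?T. g (?a x) = g x) \<and> (\<forall>x\<in>?T. g (?a x) = g x)"
      .
    also have "(\<forall>x\<in>flags C - ?T. g (?a x) = g x) \<longleftrightarrow> (\<forall>x\<in>flags C - ?T. g (arc C x) = g x)"
      by (intro ball_cong refl) simp
    finally show ?thesis .
  qed
  ultimately show ?thesis
    by (simp add: colourings_def conj_assoc)
qed

text \<open>Capping keeps the edges and their weights, so the arcs and buckles of the cap act as a
  mere filter on boundary colourings.\<close>

lemma poly_bm_capped:
  assumes C: "is_piece k C" and Cap: "Cap \<in> caps k"
  shows "poly (bm_capped k C Cap) (of_nat n) =
    (\<Sum>g | g \<in> colourings k n C \<and> boundary k C g \<in> cap_colourings k n Cap.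
      \<Prod>e\<in>edges C. edge_weight C g e :: 'a::comm_ring_1)"
proof -
  let ?s = "\<lambda>q. (\<lambda>m. strand C ` m) ` q"
  have M: "partition_on (strand_ends k) (fst Cap)" and Q: "snd Cap \<subseteq> buckle_sites (fst Cap)"
    using Cap by (auto simp: caps_def buckle_sites_def)
  have "finite (fst Cap)"
    using partition_onD1[OF M] finite_strand_ends[of k] finite_UnionD by metis
  then have fin: "finite (?s ` snd Cap)"
    using Q by (intro finite_imageI) (rule finite_subset[OF _ finite_buckle_sites])
  have ends: "\<Union>q \<subseteq> strand_ends k" if "q \<in> snd Cap" for q
    using that Q partition_onD1[OF M] by (fastforce simp: buckle_sites_def)
  have un: "\<Union>(?s q) = strand C ` \<Union>q" for q by blast
  have sub: "\<Union>m \<subseteq> flags (close_up k C Cap)" if "m \<in> ?s ` snd Cap" for m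
    using that ends is_piece_strand(1)[OF C] un by fastforce
  have mono: "monochrome g (\<Union>(?s q)) \<longleftrightarrow> monochrome (boundary k C g) (\<Union>q)"
    if "q \<in> snd Cap" for g q
    unfolding un monochrome_image using ends[OF that]
    by (intro monochrome_cong) (auto simp: boundary_def)
  have "boundary k C g \<in> cap_colourings k n Cap \<longleftrightarrow>
      (\<forall>m\<in>fst Cap. monochrome (boundary k C g) m) \<and> (\<forall>q\<in>snd Cap. \<not> monochrome g (\<Union>(?s q)))"
    if "g \<in> colourings k n C" for g
    using boundary_in_PiE[OF C that] mono by (simp add: cap_colourings_def)
  then have eq: "{g \<in> colourings 0 n (close_up k C Cap). \<forall>m\<in>?s ` snd Cap. \<not> monochrome g (\<Union>m)} =
      {g \<in> colourings k n C. boundary k C g \<in> cap_colourings k n Cap}"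
    unfolding colourings_close_up[OF C Cap] by auto
  show ?thesis
    using poly_bm_polynomial[OF is_piece_close_up[OF C Cap] fin sub, of n]
    unfolding eq close_up_simps bm_capped_def .
qed

section \<open>Flags and edges after insertion\<close>

lemma cross_in_edge_of: "cross G x \<in> edge_of G x"
  by (simp add: edge_of_def)

lemma along_in_edge_of: "along G x \<in> edge_of G x"
  by (simp add: edge_of_def)

lemma Plus_Diff: "(A <+> B) - (A' <+> B') = (A - A') <+> (B - B')"
  by auto

locale insertion =
  fixes k :: nat and G :: "'g piece" and C :: "'f piece"
  assumes G: "is_piece k G" and unique: "spokes_unique k G" and C: "is_piece k C"
begin

abbreviation "H \<equiv> insert_config k G C"
abbreviation "sG \<equiv> strand G ` strand_ends k"
abbreviation "sC \<equiv> strand C ` strand_ends k"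

text \<open>The relation \<open>R\<close> of \<open>insert_config\<close>; the classes it generates
  are the sides of the glued ribbons, each followed through all its portions.\<close>

definition portions :: "(('g + 'f) \<times> ('g + 'f)) set" where
  "portions = (\<lambda>x. (x, map_sum (along G) (along C) x)) ` (flags G <+> flags C) \<union>
     (\<lambda>p. (Inl (strand G p), Inr (strand C p))) ` strand_ends k"

text \<open>
  The spokes of the exterior only prolong the spokes of the configuration: \<open>rep\<close> moves each
  flag of \<open>C\<close> on the circle to the far end of the spoke of \<open>G\<close> glued to it.
\<close>

definition rep :: "'f \<Rightarrow> 'g + 'f" where
  "rep x = (if x \<in> sC then Inl (along G (strand G (inv_into (strand_ends k) (strand C) x))) else Inr x)"

text \<open>The corners of the exterior ribbons that do not reach the circle. Every other exterior
  corner that survives the gluing is the far end of a spoke and is a value of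
  \<open>rep\<close>.\<close>

definition inner :: "'g set" where
  "inner = {y \<in> flags G. edge_of G y \<inter> sG = {}}"

lemma flags_H: "flags H = (flags G - sG) <+> (flags C - sC)"
  by (simp add: insert_config_def Let_def Plus_Diff)

lemma flags_H_iff [simp]:
  "Inl y \<in> flags H \<longleftrightarrow> y \<in> flags G \<and> y \<notin> sG"
  "Inr x \<in> flags H \<longleftrightarrow> x \<in> flags C \<and> x \<notin> sC"
  by (auto simp: flags_H)

lemma discs_H: "discs H = discs G <+> discs C"
  by (simp add: insert_config_def Let_def)

lemma cross_H: "cross H = map_sum (cross G) (cross C)"
  by (simp add: insert_config_def Let_def)

lemma arc_H: "arc H = map_sum (arc G) (arc C)"
  by (simp add: insert_config_def Let_def)

section \<open>Sides of ribbons in the glued graph\<close>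

lemma along_H: "along H = (\<lambda>x. THE y. y \<in> flags H \<and> y \<noteq> x \<and> (x, y) \<in> (portions \<union> portions\<inverse>)\<^sup>*)"
  by (simp add: insert_config_def Let_def portions_def)

lemma inj_strand: "inj_on (strand G) (strand_ends k)" "inj_on (strand C) (strand_ends k)"
  using G C by (simp_all add: is_piece_def)

lemma rep_strand: "p \<in> strand_ends k \<Longrightarrow> rep (strand C p) = Inl (along G (strand G p))"
  by (simp add: rep_def inv_into_f_f inj_strand)

lemma rep_Inr: "x \<notin> sC \<Longrightarrow> rep x = Inr x"
  by (simp add: rep_def)

text \<open>Uniqueness of the spokes enters here: an exterior side running from the circle back to
  the circle would put two spoke ends on one edge.\<close>

lemma along_strand_notin:
  assumes p: "p \<in> strand_ends k"
  shows "along G (strand G p) \<notin> sG"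
proof
  assume "along G (strand G p) \<in> sG"
  then obtain q where q: "q \<in> strand_ends k" "along G (strand G p) = strand G q" by blast
  have edge: "edge_of G (strand G (fst r, False)) = edge_of G (strand G r)" if "r \<in> strand_ends k" for r
  proof (cases "snd r")
    case True
    then have "strand G (fst r, False) = cross G (strand G r)"
      using is_piece_strand(2)[OF G that] by simp
    then show ?thesis
      using edge_of_eq[OF G is_piece_strand(1)[OF G that] cross_in_edge_of] by simp
  next
    case False
    then have "(fst r, False) = r" by (simp add: prod_eq_iff)
    then show ?thesis by simp
  qed
  have "edge_of G (strand G q) = edge_of G (strand G p)"
    using edge_of_eq[OF G is_piece_strand(1)[OF G p] along_in_edge_of] q(2) by simp
  then have "edge_of G (strand G (fst q, False)) = edge_of G (strand G (fst p, False))"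
    using edge p q(1) by simp
  moreover have "fst p \<in> {..<k}" "fst q \<in> {..<k}"
    using p q(1) by (auto simp: strand_ends_def)
  ultimately have "fst p = fst q"
    using unique unfolding spokes_unique_def inj_on_def by metis
  \<comment> \<open>Only the two corners of one ribbon end remain, and \<open>along\<close> maps a
    corner neither to itself nor to its \<open>cross\<close> neighbour.\<close>
  then have "q = p \<or> q = (fst p, \<not> snd p)"
    by (auto simp: prod_eq_iff)
  then show False
    using is_piece_strand(2)[OF G p] is_piece_along(2,4)[OF G is_piece_strand(1)[OF G p]] q(2) by auto
qed

text \<open>The closed set \<open>T\<close> contains the class of \<open>z\<close>, so
  \<open>z\<close> and \<open>w\<close> are its only surviving corners, which settles the
  description in \<open>along H\<close>.\<close>

lemma along_H_eqI:
  assumes "w \<in> flags H" "w \<noteq> z" "(z, w) \<in> (portions \<union> portions\<inverse>)\<^sup>*"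
    and z: "z \<in> T"
    and closed: "\<And>u v. (u, v) \<in> portions \<Longrightarrow> u \<in> T \<longleftrightarrow> v \<in> T"
    and T: "\<And>y. y \<in> T \<Longrightarrow> y \<in> flags H \<Longrightarrow> y = z \<or> y = w"
  shows "along H z = w"
proof -
  have "y \<in> T" if "(z, y) \<in> (portions \<union> portions\<inverse>)\<^sup>*" for y
    using that by (induction rule: rtrancl_induct) (use z closed in auto)
  then show ?thesis
    unfolding along_H using assms(1-3) T by (intro the_equality) blast+
qed

lemma portions_cases:
  assumes "(u, v) \<in> portions"
  obtains (outside) y where "y \<in> flags G" "u = Inl y" "v = Inl (along G y)"
    | (inside) x where "x \<in> flags C" "u = Inr x" "v = Inr (along C x)"
    | (glued) p where "p \<in> strand_ends k" "u = Inl (strand G p)" "v = Inr (strand C p)"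
  using assms unfolding portions_def by auto

lemma inner_notin: "y \<in> inner \<Longrightarrow> y \<in> flags G \<and> y \<notin> sG \<and> along G y \<notin> sG \<and> cross G y \<notin> sG"
  unfolding inner_def edge_of_def by blast

lemma inner_closed: "y \<in> inner \<Longrightarrow> x \<in> edge_of G y \<Longrightarrow> x \<in> inner"
  using edge_of_eq[OF G] edge_of_subset[OF G] unfolding inner_def by blast

lemma inner_along: "y \<in> inner \<Longrightarrow> along G y \<in> inner"
  by (erule inner_closed) (rule along_in_edge_of)

lemma inner_cross: "y \<in> inner \<Longrightarrow> cross G y \<in> inner"
  by (erule inner_closed) (rule cross_in_edge_of)

text \<open>No gluing pair touches a side that misses the circle, so its two corners form a class by
  themselves.\<close>

lemma along_inner:
  assumes y: "y \<in> inner"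
  shows "along H (Inl y) = Inl (along G y)"
proof (rule along_H_eqI[where T = "{Inl y, Inl (along G y)}"])
  note n = inner_notin[OF y]
  note al = is_piece_along[OF G, of y]
  show "Inl (along G y) \<in> flags H" using n al(1) by simp
  show "Inl (along G y) \<noteq> (Inl y :: 'g + 'f)" using n al(2) by simp
  have "(Inl y, Inl (along G y)) \<in> portions"
    unfolding portions_def using n by force
  then show "(Inl y, Inl (along G y)) \<in> (portions \<union> portions\<inverse>)\<^sup>*" by blast
  fix u v assume "(u, v) \<in> portions"
  then show "u \<in> {Inl y, Inl (along G y)} \<longleftrightarrow> v \<in> {Inl y, Inl (along G y)}"
  proof (cases rule: portions_cases)
    case (outside x)
    have "along G x = y \<longleftrightarrow> x = along G y" "along G x = along G y \<longleftrightarrow> x = y"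
      using is_piece_along(3)[OF G outside(1)] al(3) n by metis+
    then show ?thesis
      unfolding outside(2,3) insert_iff empty_iff sum.inject by blast
  next
    case (glued p)
    then have "strand G p \<in> sG" by blast
    then have "strand G p \<noteq> y" "strand G p \<noteq> along G y" using n by metis+
    then show ?thesis using glued by auto
  qed auto
qed auto

lemma glued_portions: "p \<in> strand_ends k \<Longrightarrow> (rep (strand C p), Inr (strand C p)) \<in> (portions \<union> portions\<inverse>)\<^sup>*"
proof -
  assume p: "p \<in> strand_ends k"
  have "(Inl (strand G p), Inl (along G (strand G p))) \<in> portions"
    unfolding portions_def using is_piece_strand(1)[OF G p] by force
  moreover have "(Inl (strand G p), Inr (strand C p)) \<in> portions"
    unfolding portions_def using p by blast
  ultimately show ?thesis
    unfolding rep_strand[OF p] by (meson UnCI converseI r_into_rtrancl rtrancl_trans)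
qed

lemma rep_portions: "(rep x, Inr x) \<in> (portions \<union> portions\<inverse>)\<^sup>*"
proof (cases "x \<in> sC")
  case True
  then show ?thesis using glued_portions by blast
qed (simp add: rep_Inr)

lemma rep_in_flags: "x \<in> flags C \<Longrightarrow> rep x \<in> flags H"
proof (cases "x \<in> sC")
  case True
  then obtain p where p: "p \<in> strand_ends k" "x = strand C p" by blast
  then show ?thesis
    using along_strand_notin is_piece_along(1)[OF G is_piece_strand(1)[OF G]]
    by (simp add: rep_strand)
qed (simp add: rep_Inr)

lemma along_strand_eq_iff:
  assumes "p \<in> strand_ends k" "q \<in> strand_ends k"
  shows "along G (strand G p) = along G (strand G q) \<longleftrightarrow> p = q"
  using is_piece_along(3)[OF G is_piece_strand(1)[OF G assms(1)]]
    is_piece_along(3)[OF G is_piece_strand(1)[OF G assms(2)]] inj_strand(1) assms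
  by (metis inj_on_eq_iff)

lemma inj_rep: "inj rep"
proof (rule injI)
  fix x y assume eq: "rep x = rep y"
  consider "x \<in> sC" "y \<in> sC" | "x \<notin> sC" "y \<notin> sC" | "x \<in> sC" "y \<notin> sC" | "x \<notin> sC" "y \<in> sC" by blast
  then show "x = y"
  proof cases
    case 1
    then obtain p q where "p \<in> strand_ends k" "x = strand C p" "q \<in> strand_ends k" "y = strand C q"
      by blast
    then show ?thesis using eq along_strand_eq_iff by (simp add: rep_strand)
  qed (use eq in \<open>auto simp: rep_Inr rep_strand\<close>)
qed

text \<open>The gluing merely prolongs a side of a ribbon of \<open>C\<close> by exterior portions,
  and \<open>rep\<close> names the ends of the prolonged side.\<close>

lemma along_rep:
  assumes x: "x \<in> flags C"
  shows "along H (rep x) = rep (along C x)"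
proof -
  \<comment> \<open>The whole glued side: the side of \<open>C\<close> through \<open>x\<close>,
    together with the exterior portion at each of its ends that lies on the circle.\<close>
  define T where "T = {z. case z of
      Inl y \<Rightarrow> \<exists>p\<in>strand_ends k. strand C p \<in> {x, along C x} \<and> (y = strand G p \<or> y = along G (strand G p))
    | Inr y \<Rightarrow> y \<in> {x, along C x}}"
  note al = is_piece_along[OF C x]
  show ?thesis
  proof (rule along_H_eqI[where T = T])
    show "rep (along C x) \<in> flags H" using al(1) by (rule rep_in_flags)
    show "rep (along C x) \<noteq> rep x" using al(2) inj_rep by (simp add: inj_eq)
    have sym: "sym ((portions \<union> portions\<inverse>)\<^sup>*)"
      by (simp add: sym_rtrancl sym_Un_converse)
    have "(Inr x, Inr (along C x)) \<in> portions"
      unfolding portions_def using x by force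
    then have "(Inr x, Inr (along C x)) \<in> (portions \<union> portions\<inverse>)\<^sup>*" by blast
    then show "(rep x, rep (along C x)) \<in> (portions \<union> portions\<inverse>)\<^sup>*"
      using rep_portions[of x] symD[OF sym rep_portions[of "along C x"]] by (meson rtrancl_trans)
    show "rep x \<in> T"
    proof (cases "x \<in> sC")
      case True
      then obtain p where p: "p \<in> strand_ends k" "x = strand C p" by blast
      then show ?thesis by (auto simp: rep_strand T_def)
    qed (simp add: rep_Inr T_def)
  next
    fix u v assume "(u, v) \<in> portions"
    then show "u \<in> T \<longleftrightarrow> v \<in> T"
    proof (cases rule: portions_cases)
      case (outside y)
      have "along G y = strand G p \<longleftrightarrow> y = along G (strand G p)"
        "along G y = along G (strand G p) \<longleftrightarrow> y = strand G p" if "p \<in> strand_ends k" for p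
        using is_piece_along(3)[OF G outside(1)] is_piece_along(3)[OF G is_piece_strand(1)[OF G that]]
        by metis+
      then have "(y = strand G p \<or> y = along G (strand G p)) \<longleftrightarrow>
          (along G y = strand G p \<or> along G y = along G (strand G p))" if "p \<in> strand_ends k" for p
        using that by blast
      then show ?thesis unfolding outside T_def by simp
    next
      case (inside z)
      have "along C z = x \<longleftrightarrow> z = along C x" "along C z = along C x \<longleftrightarrow> z = x"
        using is_piece_along(3)[OF C inside(1)] al(3) by metis+
      then show ?thesis unfolding inside T_def mem_Collect_eq sum.case insert_iff empty_iff by blast
    next
      case (glued p)
      \<comment> \<open>The far end of an exterior portion is off the circle, so gluing pairs meet
        the portion at \<open>strand G q\<close> alone.\<close>
      have "strand G p = strand G q \<longleftrightarrow> p = q" "strand G p \<noteq> along G (strand G q)"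
        if "q \<in> strand_ends k" for q
        using inj_on_eq_iff[OF inj_strand(1) glued(1) that] along_strand_notin[OF that] glued(1)
        by (simp, metis imageI)
      then show ?thesis
        unfolding glued T_def mem_Collect_eq sum.case insert_iff empty_iff using glued(1) by metis
    qed
  next
    fix y assume y: "y \<in> T" "y \<in> flags H"
    show "y = rep x \<or> y = rep (along C x)"
    proof (cases y)
      case (Inr z)
      then have "z \<notin> sC" "z = x \<or> z = along C x" using y unfolding T_def by auto
      then show ?thesis using Inr by (metis rep_Inr)
    next
      case (Inl z)
      then obtain p where "p \<in> strand_ends k" "strand C p \<in> {x, along C x}" "z = along G (strand G p)"
        using y unfolding T_def by auto
      then show ?thesis using Inl by (metis insertE rep_strand singletonD)
    qed
  qed
qed

text \<open>Moving to the far end of an exterior spoke respects \<open>cross\<close>, because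
  \<open>along\<close> and \<open>cross\<close> commute in \<open>G\<close>.\<close>

lemma cross_rep:
  assumes x: "x \<in> flags C"
  shows "cross H (rep x) = rep (cross C x)"
proof (cases "x \<in> sC")
  case True
  then obtain p where p: "p \<in> strand_ends k" "x = strand C p" by blast
  show ?thesis
    unfolding p(2) using is_piece_strand(2,3)[OF C p(1)] is_piece_strand(1,2)[OF G p(1)]
    by (simp add: rep_strand p(1) cross_H flip: is_piece_along(5)[OF G])
next
  case False
  then show ?thesis
    using is_piece_cross_strand_iff[OF C x] by (simp add: rep_Inr cross_H)
qed

text \<open>A surviving corner of \<open>G\<close> outside \<open>inner\<close> sits on a spoke; as
  both corners of its own ribbon end are off the circle, those of the other end are on it.\<close>

lemma flags_H_eq: "flags H = Inl ` inner \<union> rep ` flags C"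
proof -
  have "Inl y \<in> Inl ` inner \<union> rep ` flags C" if y: "y \<in> flags G" "y \<notin> sG" for y
  proof (cases "y \<in> inner")
    case False
    have "cross G y \<notin> sG" using is_piece_cross_strand_iff[OF G y(1)] y(2) by simp
    moreover from this have "along G (cross G y) \<in> sG \<longleftrightarrow> along G y \<in> sG"
      using is_piece_cross_strand_iff[OF G is_piece_along(1)[OF G y(1)]] is_piece_along(5)[OF G y(1)]
      by simp
    ultimately have "along G y \<in> sG"
      using False y unfolding inner_def edge_of_def by blast
    then obtain p where p: "p \<in> strand_ends k" "along G y = strand G p" by blast
    then have "y = along G (strand G p)"
      using is_piece_along(3)[OF G y(1)] by simp
    then have "Inl y = rep (strand C p)" using p by (simp add: rep_strand)
    then show ?thesis using is_piece_strand(1)[OF C p(1)] by blast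
  qed blast
  moreover have "Inr x \<in> rep ` flags C" if "x \<in> flags C" "x \<notin> sC" for x
    using that by (metis imageI rep_Inr)
  ultimately have "flags H \<subseteq> Inl ` inner \<union> rep ` flags C"
    unfolding flags_H by auto
  moreover have "Inl ` inner \<subseteq> flags H"
    using inner_notin by (auto simp: flags_H)
  ultimately show ?thesis using rep_in_flags by blast
qed

lemma rep_notin_inner: "x \<in> flags C \<Longrightarrow> rep x \<notin> Inl ` inner"
proof (cases "x \<in> sC")
  case True
  then obtain p where p: "p \<in> strand_ends k" "x = strand C p" by blast
  have "along G (along G (strand G p)) \<in> sG"
    using is_piece_along(3)[OF G is_piece_strand(1)[OF G p(1)]] p(1) by simp
  then show ?thesis
    using inner_notin p by (auto simp: rep_strand)
qed (auto simp: rep_Inr)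

lemma edge_of_H:
  "y \<in> inner \<Longrightarrow> edge_of H (Inl y) = Inl ` edge_of G y"
  "x \<in> flags C \<Longrightarrow> edge_of H (rep x) = rep ` edge_of C x"
proof -
  assume y: "y \<in> inner"
  have "cross H (Inl y) = Inl (cross G y)" by (simp add: cross_H)
  then show "edge_of H (Inl y) = Inl ` edge_of G y"
    using along_inner[OF y] along_inner[OF inner_cross[OF y]] by (simp add: edge_of_def)
next
  assume x: "x \<in> flags C"
  show "edge_of H (rep x) = rep ` edge_of C x"
    using along_rep[OF x] along_rep[OF is_piece_cross(1)[OF C x]] cross_rep[OF x]
    by (simp add: edge_of_def)
qed

text \<open>Each ribbon of \<open>C\<close> yields one edge, which absorbs the exterior spokes glued
  to it; the other exterior ribbons are edges as before.\<close>

lemma edges_H: "edges H = image Inl ` edge_of G ` inner \<union> image rep ` edges C"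
  unfolding edges_def flags_H_eq image_Un image_image
  by (intro arg_cong2[where f = "(\<union>)"] image_cong refl) (simp_all add: edge_of_H)

text \<open>\<open>cross\<close> and \<open>arc\<close> are inherited corner by corner; the laws for
  \<open>along\<close> are transported from \<open>G\<close> on \<open>inner\<close> and from
  \<open>C\<close> through \<open>rep\<close>.\<close>

lemma is_piece_insert_config: "is_piece 0 H"
proof -
  have fin: "finite (flags H)" "finite (discs H)" "flags H \<inter> discs H = {}"
    using G C by (auto simp: flags_H discs_H is_piece_def)
  have cross: "cross H z \<in> flags H \<and> cross H z \<noteq> z \<and> cross H (cross H z) = z" if "z \<in> flags H" for z
  proof (cases z)
    case (Inl y)
    then have "y \<in> flags G" "y \<notin> sG" using that by (auto simp: flags_H)
    then show ?thesis
      using Inl is_piece_cross[OF G] is_piece_cross_strand_iff[OF G] by (simp add: cross_H)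
  next
    case (Inr y)
    then have "y \<in> flags C" "y \<notin> sC" using that by (auto simp: flags_H)
    then show ?thesis
      using Inr is_piece_cross[OF C] is_piece_cross_strand_iff[OF C] by (simp add: cross_H)
  qed
  have along: "along H z \<in> flags H \<and> along H z \<noteq> z \<and> along H (along H z) = z \<and>
      along H z \<noteq> cross H z \<and> along H (cross H z) = cross H (along H z)" if "z \<in> flags H" for z
  proof -
    from that consider y where "y \<in> inner" "z = Inl y" | x where "x \<in> flags C" "z = rep x"
      unfolding flags_H_eq by blast
    then show ?thesis
    proof cases
      case 1
      note al = is_piece_along[OF G inner_notin[THEN conjunct1, OF 1(1)]]
      show ?thesis
        unfolding 1(2) using al along_inner[OF 1(1)] along_inner[OF inner_along[OF 1(1)]]
          along_inner[OF inner_cross[OF 1(1)]] inner_along[OF 1(1)]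
        by (simp add: cross_H flags_H_eq)
    next
      case 2
      note al = is_piece_along[OF C 2(1)] and cr = is_piece_cross[OF C 2(1)]
      show ?thesis
        unfolding 2(2) using al cr inj_rep rep_in_flags
        by (simp add: along_rep cross_rep 2(1) inj_eq)
    qed
  qed
  have arc: "arc H z \<in> flags H \<and> arc H z \<noteq> z \<and> arc H (arc H z) = z" if "z \<in> flags H" for z
  proof (cases z)
    case (Inl y)
    then have "y \<in> flags G" "y \<notin> sG" using that by (auto simp: flags_H)
    then show ?thesis
      using Inl is_piece_arc[OF G] by (simp add: arc_H)
  next
    case (Inr y)
    then have "y \<in> flags C" "y \<notin> sC" using that by (auto simp: flags_H)
    then show ?thesis
      using Inr is_piece_arc[OF C] by (simp add: arc_H)
  qed
  show ?thesis
    using fin cross along arc by (simp add: is_piece_def fpf_involution_on_def)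
qed

end

section \<open>Cutting along the circle\<close>

lemma ex_recolouring:
  fixes \<kappa> \<mu> :: "'s \<Rightarrow> nat"
  assumes "\<kappa> \<in> S \<rightarrow>\<^sub>E {..<n}" "\<mu> \<in> S \<rightarrow>\<^sub>E {..<n}" and K: "same_kernel S \<kappa> \<mu>"
  obtains \<sigma> where "bij_betw \<sigma> {..<n} {..<n}" "\<And>x. x \<in> S \<Longrightarrow> \<sigma> (\<kappa> x) = \<mu> x"
proof -
  have sub: "\<kappa> ` S \<subseteq> {..<n}" "\<mu> ` S \<subseteq> {..<n}"
    using assms(1,2) by auto
  define \<theta> where "\<theta> = (\<lambda>c. \<mu> (inv_into S \<kappa> c))"
  have \<theta>: "\<theta> (\<kappa> x) = \<mu> x" if "x \<in> S" for x
  proof -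
    have "inv_into S \<kappa> (\<kappa> x) \<in> S" "\<kappa> (inv_into S \<kappa> (\<kappa> x)) = \<kappa> x"
      using that by (auto intro: inv_into_into f_inv_into_f)
    then show ?thesis using K that unfolding same_kernel_def \<theta>_def by blast
  qed
  have bij: "bij_betw \<theta> (\<kappa> ` S) (\<mu> ` S)"
  proof (rule bij_betw_imageI)
    show "inj_on \<theta> (\<kappa> ` S)"
    proof (rule inj_onI, safe)
      fix x y assume "x \<in> S" "y \<in> S" "\<theta> (\<kappa> x) = \<theta> (\<kappa> y)"
      then show "\<kappa> x = \<kappa> y" using K by (simp add: \<theta> same_kernel_def)
    qed
    show "\<theta> ` \<kappa> ` S = \<mu> ` S" using \<theta> by (simp add: image_image)
  qed
  then have "card (\<kappa> ` S) = card (\<mu> ` S)" by (rule bij_betw_same_card)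
  then have "card ({..<n} - \<kappa> ` S) = card ({..<n} - \<mu> ` S)"
    using sub by (simp add: card_Diff_subset finite_subset[OF _ finite_lessThan])
  then obtain \<psi> where \<psi>: "bij_betw \<psi> ({..<n} - \<kappa> ` S) ({..<n} - \<mu> ` S)"
    using finite_same_card_bij by blast
  define \<sigma> where "\<sigma> = (\<lambda>c. if c \<in> \<kappa> ` S then \<theta> c else \<psi> c)"
  have "bij_betw \<sigma> (\<kappa> ` S \<union> ({..<n} - \<kappa> ` S)) (\<mu> ` S \<union> ({..<n} - \<mu> ` S))"
    unfolding \<sigma>_def by (rule bij_betw_disjoint_Un[OF bij \<psi>]) auto
  moreover have "\<kappa> ` S \<union> ({..<n} - \<kappa> ` S) = {..<n}" "\<mu> ` S \<union> ({..<n} - \<mu> ` S) = {..<n}"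
    using sub by auto
  ultimately have "bij_betw \<sigma> {..<n} {..<n}" by simp
  moreover have "\<sigma> (\<kappa> x) = \<mu> x" if "x \<in> S" for x
    using that \<theta> by (simp add: \<sigma>_def)
  ultimately show ?thesis using that by blast
qed

text \<open>The corners on the circle carry no colour, since they disappear in the gluing.\<close>

definition exterior_colourings :: "nat \<Rightarrow> nat \<Rightarrow> 'f piece \<Rightarrow> ('f \<Rightarrow> nat) set" where
  "exterior_colourings k n G = {g \<in> (flags G - strand G ` strand_ends k) \<union> discs G \<rightarrow>\<^sub>E {..<n}.
     \<forall>x\<in>flags G - strand G ` strand_ends k. g (arc G x) = g x}"

text \<open>The spokes are left out because they are counted with the edges of the
  configuration.\<close>

definition exterior_edges :: "nat \<Rightarrow> 'f piece \<Rightarrow> 'f set set" where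
  "exterior_edges k G = {e \<in> edges G. e \<inter> strand G ` strand_ends k = {}}"

text \<open>Read at the far ends of the spokes, where \<open>rep\<close> puts the strand ends of the
  configuration.\<close>

definition exterior_boundary :: "nat \<Rightarrow> 'f piece \<Rightarrow> ('f \<Rightarrow> nat) \<Rightarrow> nat \<times> bool \<Rightarrow> nat" where
  "exterior_boundary k G g = (\<lambda>p\<in>strand_ends k. g (along G (strand G p)))"

definition exterior_sum :: "nat \<Rightarrow> nat \<Rightarrow> 'f piece \<Rightarrow> (nat \<times> bool \<Rightarrow> nat) \<Rightarrow> 'a::comm_ring_1" where
  "exterior_sum k n G \<kappa> = (\<Sum>g | g \<in> exterior_colourings k n G \<and> exterior_boundary k G g = \<kappa>.
     \<Prod>e\<in>exterior_edges k G. edge_weight G g e)"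

section \<open>Invariance of the exterior factor under recolouring\<close>

lemma along_strand_exterior:
  assumes "is_piece k G" "spokes_unique k G" "p \<in> strand_ends k"
  shows "along G (strand G p) \<in> flags G - strand G ` strand_ends k"
proof -
  \<comment> \<open>The locale asks for some configuration; \<open>G\<close> itself serves, as only
    a fact about the exterior is drawn from it.\<close>
  interpret insertion k G G using assms by unfold_locales
  show ?thesis
    using along_strand_notin[OF assms(3)] is_piece_along(1)[OF assms(1) is_piece_strand(1)[OF assms(1,3)]]
    by blast
qed

lemma exterior_edgesD:
  assumes "is_piece k G" "e \<in> exterior_edges k G" "x \<in> e"
  shows "x \<in> flags G" "x \<notin> strand G ` strand_ends k" "along G x \<in> e" "cross G x \<in> e"
proof -
  obtain y where y: "y \<in> flags G" "e = edge_of G y"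
    using assms(2) by (auto simp: exterior_edges_def edges_def)
  have "edge_of G x = e"
    using assms(3) unfolding y(2) by (rule edge_of_eq[OF assms(1) y(1)])
  then show "along G x \<in> e" "cross G x \<in> e"
    using along_in_edge_of[of G x] cross_in_edge_of[of G x] by simp_all
  show "x \<in> flags G" using edge_of_subset[OF assms(1) y(1)] y(2) assms(3) by blast
  show "x \<notin> strand G ` strand_ends k" using assms(2,3) by (auto simp: exterior_edges_def)
qed

lemma edge_weight_cong:
  assumes "\<And>x. x \<in> e \<Longrightarrow> along G x \<in> e" "\<And>x. x \<in> e \<Longrightarrow> cross G x \<in> e"
    and "\<And>x y. x \<in> e \<Longrightarrow> y \<in> e \<Longrightarrow> g x = g y \<longleftrightarrow> h x = h y"
  shows "edge_weight G g e = edge_weight G h e"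
  unfolding edge_weight_def using assms by (simp cong: ball_cong)

text \<open>Applying \<open>\<sigma>\<close> is a bijection between the index sets of the two sums,
  and an edge weight depends only on which colours agree.\<close>

lemma exterior_sum_recolour:
  assumes G: "is_piece k G" "spokes_unique k G"
    and \<sigma>: "bij_betw \<sigma> {..<n} {..<n}" "\<And>p. p \<in> strand_ends k \<Longrightarrow> \<sigma> (\<kappa> p) = \<mu> p"
    and \<kappa>: "\<kappa> \<in> strand_ends k \<rightarrow>\<^sub>E {..<n}" and \<mu>: "\<mu> \<in> strand_ends k \<rightarrow>\<^sub>E {..<n}"
  shows "exterior_sum k n G \<kappa> = exterior_sum k n G \<mu>"
proof -
  let ?X = "(flags G - strand G ` strand_ends k) \<union> discs G"
  let ?\<tau> = "inv_into {..<n} \<sigma>"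
  note ext = along_strand_exterior[OF G]
  have inv: "?\<tau> (\<sigma> c) = c" "\<sigma> (?\<tau> c) = c" "\<sigma> c < n" "?\<tau> c < n" if "c < n" for c
    using \<sigma>(1) that bij_betw_inv_into_left[OF \<sigma>(1)] bij_betw_inv_into_right[OF \<sigma>(1)]
      bij_betwE[OF \<sigma>(1)] bij_betwE[OF bij_betw_inv_into[OF \<sigma>(1)]] by auto
  have range: "g x < n" if "g \<in> exterior_colourings k n G" "x \<in> ?X" for g x
    using that by (auto simp: exterior_colourings_def)
  have arcX: "arc G x \<in> flags G - strand G ` strand_ends k" if "x \<in> flags G - strand G ` strand_ends k" for x
    using that is_piece_arc[OF G(1)] by blast
  have recolour: "(\<lambda>x\<in>?X. \<rho> (g x)) \<in> exterior_colourings k n G"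
    if "g \<in> exterior_colourings k n G" "\<And>c. c < n \<Longrightarrow> \<rho> c < n" for g \<rho>
    using that range[OF that(1)] arcX by (auto simp: exterior_colourings_def)
  have bd: "exterior_boundary k G (\<lambda>x\<in>?X. \<rho> (g x)) = \<nu>'"
    if "exterior_boundary k G g = \<nu>" "\<nu>' \<in> strand_ends k \<rightarrow>\<^sub>E {..<n}"
      "\<And>p. p \<in> strand_ends k \<Longrightarrow> \<rho> (\<nu> p) = \<nu>' p" for g \<rho> \<nu> \<nu>'
  proof
    fix p show "exterior_boundary k G (\<lambda>x\<in>?X. \<rho> (g x)) p = \<nu>' p"
    proof (cases "p \<in> strand_ends k")
      case True
      have "\<nu> p = g (along G (strand G p))"
        using True by (simp add: exterior_boundary_def flip: that(1))
      then show ?thesis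
        using True ext[OF True] that(3)[OF True] by (simp add: exterior_boundary_def)
    next
      case False
      then show ?thesis using PiE_arb[OF that(2)] by (simp add: exterior_boundary_def)
    qed
  qed
  have \<tau>\<mu>: "?\<tau> (\<mu> p) = \<kappa> p" if "p \<in> strand_ends k" for p
    using inv(1)[of "\<kappa> p"] \<sigma>(2)[OF that] PiE_mem[OF \<kappa> that] by simp
  have undo: "(\<lambda>x\<in>?X. \<rho>' ((\<lambda>x\<in>?X. \<rho> (g x)) x)) = g"
    if "g \<in> exterior_colourings k n G" "\<And>c. c < n \<Longrightarrow> \<rho>' (\<rho> c) = c" for g \<rho> \<rho>'
  proof
    fix x show "(\<lambda>x\<in>?X. \<rho>' ((\<lambda>x\<in>?X. \<rho> (g x)) x)) x = g x"
    proof (cases "x \<in> ?X")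
      case True
      then show ?thesis using that(2)[OF range[OF that(1) True]] by (simp del: Un_iff)
    next
      case False
      have "g \<in> ?X \<rightarrow>\<^sub>E {..<n}" using that(1) unfolding exterior_colourings_def by blast
      from PiE_arb[OF this False] show ?thesis using False by (simp del: Un_iff)
    qed
  qed
  show ?thesis
    unfolding exterior_sum_def
  proof (rule sum.reindex_bij_witness[where i = "\<lambda>g. \<lambda>x\<in>?X. ?\<tau> (g x)" and j = "\<lambda>g. \<lambda>x\<in>?X. \<sigma> (g x)"])
    fix g assume "g \<in> {g \<in> exterior_colourings k n G. exterior_boundary k G g = \<kappa>}"
    then have g: "g \<in> exterior_colourings k n G" "exterior_boundary k G g = \<kappa>" by auto
    show "(\<lambda>x\<in>?X. ?\<tau> ((\<lambda>x\<in>?X. \<sigma> (g x)) x)) = g"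
      by (rule undo[of g ?\<tau> \<sigma>, OF g(1) inv(1)])
    show "(\<lambda>x\<in>?X. \<sigma> (g x)) \<in> {g \<in> exterior_colourings k n G. exterior_boundary k G g = \<mu>}"
      using recolour[of g \<sigma>, OF g(1) inv(3)] bd[of g \<kappa> \<mu> \<sigma>, OF g(2) \<mu> \<sigma>(2)] by blast
    show "(\<Prod>e\<in>exterior_edges k G. edge_weight G (\<lambda>x\<in>?X. \<sigma> (g x)) e) =
      (\<Prod>e\<in>exterior_edges k G. edge_weight G g e)"
    proof (rule prod.cong[OF refl], rule edge_weight_cong)
      fix e x assume e: "e \<in> exterior_edges k G" "x \<in> e"
      show "along G x \<in> e" by (rule exterior_edgesD(3)[OF G(1) e])
      show "cross G x \<in> e" by (rule exterior_edgesD(4)[OF G(1) e])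
    next
      fix e x y assume e: "e \<in> exterior_edges k G" "x \<in> e" "y \<in> e"
      have X: "x \<in> ?X" "y \<in> ?X" using exterior_edgesD[OF G(1) e(1)] e(2,3) by auto
      have "\<sigma> (g x) = \<sigma> (g y) \<longleftrightarrow> g x = g y"
        using inv(1)[OF range[OF g(1) X(1)]] inv(1)[OF range[OF g(1) X(2)]] by metis
      then show "(\<lambda>x\<in>?X. \<sigma> (g x)) x = (\<lambda>x\<in>?X. \<sigma> (g x)) y \<longleftrightarrow> g x = g y"
        using X by (simp del: Un_iff)
    qed
  next
    fix g assume "g \<in> {g \<in> exterior_colourings k n G. exterior_boundary k G g = \<mu>}"
    then have g: "g \<in> exterior_colourings k n G" "exterior_boundary k G g = \<mu>" by auto
    show "(\<lambda>x\<in>?X. \<sigma> ((\<lambda>x\<in>?X. ?\<tau> (g x)) x)) = g"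
      by (rule undo[of g \<sigma> ?\<tau>, OF g(1) inv(2)])
    show "(\<lambda>x\<in>?X. ?\<tau> (g x)) \<in> {g \<in> exterior_colourings k n G. exterior_boundary k G g = \<kappa>}"
      using recolour[of g ?\<tau>, OF g(1) inv(4)] bd[of g \<mu> \<kappa> ?\<tau>, OF g(2) \<kappa> \<tau>\<mu>] by blast
  qed
qed

lemma exterior_sum_same_kernel:
  assumes "is_piece k G" "spokes_unique k G"
    and "\<kappa> \<in> strand_ends k \<rightarrow>\<^sub>E {..<n}" "\<mu> \<in> strand_ends k \<rightarrow>\<^sub>E {..<n}"
    and "same_kernel (strand_ends k) \<kappa> \<mu>"
  shows "exterior_sum k n G \<kappa> = exterior_sum k n G \<mu>"
proof -
  obtain \<sigma> where "bij_betw \<sigma> {..<n} {..<n}" "\<And>p. p \<in> strand_ends k \<Longrightarrow> \<sigma> (\<kappa> p) = \<mu> p"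
    using ex_recolouring[OF assms(3-5)] by blast
  then show ?thesis using assms(1-4) by (intro exterior_sum_recolour)
qed

section \<open>Factorization of the Penrose polynomial of the glued graph\<close>

context insertion
begin

lemma edges_inner: "edge_of G ` inner = exterior_edges k G"
  by (auto simp: exterior_edges_def edges_def inner_def)

lemma rep_disc: "x \<in> discs C \<Longrightarrow> rep x = Inr x"
  using C is_piece_strand(1)[OF C] by (intro rep_Inr) (auto simp: is_piece_def)

text \<open>\<open>Inl\<close> on the exterior edges and \<open>rep\<close> on the edges of
  \<open>C\<close> carry \<open>cross\<close> and \<open>along\<close> to those of the glued graph,
  so each weight can be computed in its own piece from the pulled back colouring.\<close>

lemma prod_edge_weight_H:
  "(\<Prod>e\<in>edges H. edge_weight H u e) =
   (\<Prod>e\<in>edges C. edge_weight C (\<lambda>x\<in>flags C \<union> discs C. u (rep x)) e) *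
   (\<Prod>e\<in>exterior_edges k G. edge_weight G (\<lambda>y\<in>(flags G - sG) \<union> discs G. u (Inl y)) e)"
proof -
  have fin: "finite (edges C)" "finite (exterior_edges k G)"
    using finite_edges[OF C] finite_edges[OF G] by (auto simp: exterior_edges_def)
  have disj: "image Inl ` exterior_edges k G \<inter> image rep ` edges C = {}"
  proof -
    have "Inl ` e \<noteq> rep ` e'" if e: "e \<in> exterior_edges k G" and e': "e' \<in> edges C" for e e'
    proof
      assume eq: "Inl ` e = rep ` e'"
      obtain x where x: "x \<in> flags C" "x \<in> e'" using e' by (auto simp: edges_def)
      have "rep x \<in> Inl ` e" using eq x(2) by blast
      moreover have "e \<subseteq> inner"
        using e inner_closed unfolding edges_inner[symmetric] by blast
      ultimately show False using rep_notin_inner[OF x(1)] by blast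
    qed
    then show ?thesis by blast
  qed
  have inj: "inj_on (image Inl :: _ \<Rightarrow> ('g + 'f) set) (exterior_edges k G)" "inj_on (image rep) (edges C)"
    using inj_rep by (auto simp: inj_on_def inj_image_eq_iff)
  have outer: "edge_weight H u (Inl ` e) =
      edge_weight G (\<lambda>y\<in>(flags G - sG) \<union> discs G. u (Inl y)) e" if e: "e \<in> exterior_edges k G" for e
  proof -
    have "e \<subseteq> inner" using e inner_closed unfolding edges_inner[symmetric] by blast
    then have al: "along H (Inl x) = Inl (along G x)" "along H (Inl (cross G x)) = Inl (along G (cross G x))"
      if "x \<in> e" for x using that along_inner inner_cross by blast+
    have X: "x \<in> flags G - sG" "along G x \<in> flags G - sG" "along G (cross G x) \<in> flags G - sG"
      if "x \<in> e" for x
      using exterior_edgesD[OF G e] that by blast+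
    show ?thesis
      unfolding edge_weight_def using X by (simp add: cross_H al cong: ball_cong)
  qed
  have inside: "edge_weight H u (rep ` e) =
      edge_weight C (\<lambda>x\<in>flags C \<union> discs C. u (rep x)) e" if e: "e \<in> edges C" for e
  proof -
    have X: "x \<in> flags C" "along C x \<in> flags C" "cross C x \<in> flags C" "along C (cross C x) \<in> flags C"
      if "x \<in> e" for x
      using edges_subset[OF C e] that is_piece_along(1)[OF C] is_piece_cross(1)[OF C] by blast+
    show ?thesis
      unfolding edge_weight_def using X by (simp add: cross_rep along_rep cong: ball_cong)
  qed
  have "(\<Prod>e\<in>edges H. edge_weight H u e) =
      (\<Prod>e\<in>exterior_edges k G. edge_weight H u (Inl ` e)) * (\<Prod>e\<in>edges C. edge_weight H u (rep ` e))"
    unfolding edges_H edges_inner using fin disj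
    by (simp add: prod.union_disjoint prod.reindex[OF inj(1)] prod.reindex[OF inj(2)])
  then show ?thesis
    by (simp add: outer inside mult.commute)
qed

text \<open>Colourings of the glued graph correspond to pairs of an interior and an exterior
  colouring with the same boundary: a strand end of \<open>C\<close> and the far end of the exterior
  spoke glued to it have become one corner. Summing over the exterior part first gives
  \<open>exterior_sum\<close>.\<close>

lemma poly_penrose_insert_config:
  "poly (penrose H) (of_nat n) =
   (\<Sum>h\<in>colourings k n C. exterior_sum k n G (boundary k C h) *
      (\<Prod>e\<in>edges C. edge_weight C h e) :: 'a::comm_ring_1)"
proof -
  let ?X = "(flags G - sG) \<union> discs G" and ?Y = "flags C \<union> discs C"
  let ?E = "\<lambda>h. {g \<in> exterior_colourings k n G. exterior_boundary k G g = boundary k C h}"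
  let ?inside = "\<lambda>u. \<lambda>x\<in>?Y. u (rep x)" and ?outside = "\<lambda>u. \<lambda>y\<in>?X. u (Inl y)"
  \<comment> \<open>Each surviving corner takes its colour from its own piece; the values of
    \<open>h\<close> on the circle are recovered from \<open>g\<close>.\<close>
  let ?glue = "\<lambda>(h, g). \<lambda>z\<in>flags H \<union> discs H. case_sum g h z"
  have finE: "finite (exterior_colourings k n G)"
    using G by (simp add: exterior_colourings_def is_piece_def finite_colourings)
  have Inl_iff: "(Inl y \<in> flags H \<union> discs H) \<longleftrightarrow> y \<in> ?X" for y
    by (auto simp: discs_H)
  have disc_notin: "x \<notin> sC" if "x \<in> discs C" for x
    using that C is_piece_strand(1)[OF C] by (auto simp: is_piece_def)
  have Inr_iff: "(Inr x \<in> flags H \<union> discs H) \<longleftrightarrow> x \<in> ?Y - sC" for x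
    using disc_notin by (auto simp: discs_H)
  have rep_in: "rep x \<in> flags H \<union> discs H" if "x \<in> ?Y" for x
    using that rep_in_flags rep_disc by (auto simp: discs_H)
  have ext: "along G (strand G p) \<in> ?X" if "p \<in> strand_ends k" for p
    using along_strand_exterior[OF G unique that] by blast
  have strandY: "strand C p \<in> ?Y" if "p \<in> strand_ends k" for p
    using is_piece_strand(1)[OF C that] by blast
  have arcX: "arc G x \<in> flags G - sG" if "x \<in> flags G - sG" for x
    using that is_piece_arc[OF G] by blast
  have arcY: "arc C x \<in> flags C - sC" if "x \<in> flags C - sC" for x
    using that is_piece_arc[OF C] by blast
  have "poly (penrose H) (of_nat n) = (\<Sum>u\<in>colourings 0 n H. \<Prod>e\<in>edges H. edge_weight H u e :: 'a)"
    by (rule poly_penrose[OF is_piece_insert_config])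
  also have "\<dots> = (\<Sum>(h, g)\<in>(SIGMA h:colourings k n C. ?E h).
      (\<Prod>e\<in>edges C. edge_weight C h e) * (\<Prod>e\<in>exterior_edges k G. edge_weight G g e))"
  proof (rule sum.reindex_bij_witness[where i = ?glue and j = "\<lambda>u. (?inside u, ?outside u)"])
    fix u assume u: "u \<in> colourings 0 n H"
    then have uE: "u \<in> flags H \<union> discs H \<rightarrow>\<^sub>E {..<n}" and uarc: "\<And>z. z \<in> flags H \<Longrightarrow> u (arc H z) = u z"
      by (auto simp: colourings_def)
    show "?glue (?inside u, ?outside u) = u"
    proof
      fix z show "?glue (?inside u, ?outside u) z = u z"
      proof (cases "z \<in> flags H \<union> discs H")
        case False
        then show ?thesis using PiE_arb[OF uE False] by (simp del: Un_iff)
      next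
        case True
        then show ?thesis
        proof (cases z)
          case (Inl y)
          then show ?thesis using True Inl_iff[of y] by (simp del: Un_iff)
        next
          case (Inr x)
          then show ?thesis using True Inr_iff[of x] by (simp add: rep_Inr del: Un_iff)
        qed
      qed
    qed
    have "?inside u \<in> ?Y \<rightarrow>\<^sub>E {..<n}"
      unfolding restrict_PiE_iff using PiE_mem[OF uE rep_in] by blast
    moreover have "?inside u (arc C x) = ?inside u x" if x: "x \<in> flags C - sC" for x
      using uarc[of "Inr x"] x arcY[OF x] by (simp add: rep_Inr arc_H)
    ultimately have "?inside u \<in> colourings k n C" by (simp add: colourings_def)
    moreover have "?outside u \<in> ?X \<rightarrow>\<^sub>E {..<n}"
      unfolding restrict_PiE_iff using PiE_mem[OF uE Inl_iff[THEN iffD2]] by blast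
    moreover have "?outside u (arc G x) = ?outside u x" if x: "x \<in> flags G - sG" for x
      using uarc[of "Inl x"] x arcX[OF x] by (simp add: arc_H)
    ultimately have "?inside u \<in> colourings k n C" "?outside u \<in> exterior_colourings k n G"
      unfolding exterior_colourings_def by blast+
    moreover have "exterior_boundary k G (?outside u) = boundary k C (?inside u)"
      unfolding exterior_boundary_def boundary_def
      by (rule restrict_ext) (use ext strandY in \<open>simp add: rep_strand del: Un_iff\<close>)
    ultimately show "(?inside u, ?outside u) \<in> (SIGMA h:colourings k n C. ?E h)"
      by blast
    show "(case (?inside u, ?outside u) of (h, g) \<Rightarrow>
        (\<Prod>e\<in>edges C. edge_weight C h e) * (\<Prod>e\<in>exterior_edges k G. edge_weight G g e)) =
        (\<Prod>e\<in>edges H. edge_weight H u e :: 'a)"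
      by (simp only: prod_edge_weight_H prod.case)
  next
    fix hg assume "hg \<in> (SIGMA h:colourings k n C. ?E h)"
    then obtain h g where hg: "hg = (h, g)" "h \<in> colourings k n C" "g \<in> exterior_colourings k n G"
        "exterior_boundary k G g = boundary k C h" by auto
    have hE: "h \<in> ?Y \<rightarrow>\<^sub>E {..<n}" and harc: "\<And>x. x \<in> flags C - sC \<Longrightarrow> h (arc C x) = h x"
      using hg(2) by (auto simp: colourings_def)
    have gE: "g \<in> ?X \<rightarrow>\<^sub>E {..<n}" and garc: "\<And>x. x \<in> flags G - sG \<Longrightarrow> g (arc G x) = g x"
      using hg(3) by (auto simp: exterior_colourings_def)
    have bd: "g (along G (strand G p)) = h (strand C p)" if "p \<in> strand_ends k" for p
      using fun_cong[OF hg(4), of p] that by (simp add: boundary_def exterior_boundary_def)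
    have glue_Inl: "?glue (h, g) (Inl y) = g y" if "y \<in> ?X" for y
      using that Inl_iff by (simp del: Un_iff)
    \<comment> \<open>For \<open>x\<close> on the circle \<open>rep x\<close> is an exterior corner,
      and the agreement of the two boundaries supplies the value.\<close>
    have glue_rep: "?glue (h, g) (rep x) = h x" if "x \<in> ?Y" for x
    proof (cases "x \<in> sC")
      case True
      then obtain p where p: "p \<in> strand_ends k" "x = strand C p" by blast
      then show ?thesis using glue_Inl[OF ext] bd by (simp add: rep_strand del: Un_iff)
    next
      case False
      then show ?thesis using that Inr_iff by (simp add: rep_Inr del: Un_iff)
    qed
    have "?inside (?glue (h, g)) = h"
    proof
      fix x show "?inside (?glue (h, g)) x = h x"
        using glue_rep[of x] PiE_arb[OF hE, of x] by (cases "x \<in> ?Y") (simp_all del: Un_iff prod.case)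
    qed
    moreover have "?outside (?glue (h, g)) = g"
    proof
      fix x show "?outside (?glue (h, g)) x = g x"
        using glue_Inl[of x] PiE_arb[OF gE, of x] by (cases "x \<in> ?X") (simp_all del: Un_iff prod.case)
    qed
    ultimately show "(?inside (?glue hg), ?outside (?glue hg)) = hg"
      by (simp only: hg(1))
    have glue_E: "?glue (h, g) \<in> flags H \<union> discs H \<rightarrow>\<^sub>E {..<n}"
    proof
      fix z assume z: "z \<in> flags H \<union> discs H"
      show "?glue (h, g) z \<in> {..<n}"
      proof (cases z)
        case (Inl y)
        then have "y \<in> ?X" using z Inl_iff by blast
        then show ?thesis using glue_Inl[of y] PiE_mem[OF gE] Inl by (simp del: Un_iff prod.case)
      next
        case (Inr x)
        then have x: "x \<in> ?Y" "x \<notin> sC" using z Inr_iff by blast+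
        then show ?thesis using glue_rep[of x] PiE_mem[OF hE] Inr by (simp add: rep_Inr del: Un_iff prod.case)
      qed
    qed (simp del: Un_iff)
    have "?glue (h, g) (arc H z) = ?glue (h, g) z" if z: "z \<in> flags H" for z
    proof (cases z)
      case (Inl y)
      then have y: "y \<in> flags G - sG" using z by simp
      then have "y \<in> ?X" "arc G y \<in> ?X" using arcX by blast+
      then show ?thesis
        using glue_Inl garc[OF y] Inl by (simp add: arc_H del: Un_iff prod.case)
    next
      case (Inr x)
      then have x: "x \<in> flags C - sC" using z by simp
      then have "x \<in> ?Y" "arc C x \<in> ?Y" "x \<notin> sC" "arc C x \<notin> sC" using arcY by blast+
      then show ?thesis
        using glue_rep[of x] glue_rep[of "arc C x"] harc[OF x] Inr
        by (simp add: arc_H rep_Inr del: Un_iff prod.case)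
    qed
    with glue_E show "?glue hg \<in> colourings 0 n H"
      unfolding hg(1) colourings_def by (simp del: Un_iff prod.case)
  qed
  also have "\<dots> = (\<Sum>h\<in>colourings k n C. \<Sum>g\<in>?E h.
      (\<Prod>e\<in>edges C. edge_weight C h e) * (\<Prod>e\<in>exterior_edges k G. edge_weight G g e))"
    by (rule sum.Sigma[symmetric]) (use finite_colourings_piece[OF C] finE in auto)
  also have "\<dots> = (\<Sum>h\<in>colourings k n C. exterior_sum k n G (boundary k C h) *
      (\<Prod>e\<in>edges C. edge_weight C h e))"
    by (simp add: exterior_sum_def sum_distrib_left mult.commute)
  finally show ?thesis .
qed

end

section \<open>Cancellation at every natural number, hence as polynomials\<close>

theorem corollary3p4:
  fixes k l :: nat
    and C :: "nat \<Rightarrow> 'f piece"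
    and a :: "nat \<Rightarrow> 'a::{idom, ring_char_0} poly"
  assumes "\<And>i. i \<in> {1..l} \<Longrightarrow> is_piece k (C i)"
    and "\<And>Cap. Cap \<in> caps k \<Longrightarrow> (\<Sum>i=1..l. a i * bm_capped k (C i) Cap) = 0"
  shows "\<forall>\<Gamma> :: 'g piece. is_piece k \<Gamma> \<and> spokes_unique k \<Gamma> \<longrightarrow>
           (\<Sum>i=1..l. a i * penrose (insert_config k \<Gamma> (C i))) = 0"
proof (intro allI impI, elim conjE)
  fix \<Gamma> :: "'g piece"
  assume \<Gamma>: "is_piece k \<Gamma>" "spokes_unique k \<Gamma>"
  let ?p = "\<Sum>i=1..l. a i * penrose (insert_config k \<Gamma> (C i))"
  \<comment> \<open>In an integral domain of characteristic 0 the natural numbers are infinitely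
    many distinct roots, which forces the polynomial to vanish.\<close>
  have "poly ?p (of_nat n) = 0" for n
  proof -
    let ?K = "strand_ends k \<rightarrow>\<^sub>E {..<n}"
    define W where "W = (\<lambda>i h. \<Prod>e\<in>edges (C i). edge_weight (C i) h e :: 'a)"
    \<comment> \<open>The interior factors of all configurations, weighted by the \<open>a i\<close>
      and collected by the colouring of the strand ends.\<close>
    define Z where "Z = (\<lambda>\<kappa>. \<Sum>i=1..l. poly (a i) (of_nat n) *
      (\<Sum>h | h \<in> colourings k n (C i) \<and> boundary k (C i) h = \<kappa>. W i h))"
    have finK: "finite ?K" by (simp add: finite_PiE)
    have fin: "finite (colourings k n (C i))" if "i \<in> {1..l}" for i
      using finite_colourings_piece[OF assms(1)[OF that]] .
    have fibres: "(\<Sum>\<kappa>\<in>K. f \<kappa> * (\<Sum>h | h \<in> colourings k n (C i) \<and> boundary k (C i) h = \<kappa>. W i h)) =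
        (\<Sum>h | h \<in> colourings k n (C i) \<and> boundary k (C i) h \<in> K. f (boundary k (C i) h) * W i h)"
      if "i \<in> {1..l}" "finite K" for i K f
    proof -
      let ?D = "{h \<in> colourings k n (C i). boundary k (C i) h \<in> K}"
      have "(\<Sum>h\<in>?D. f (boundary k (C i) h) * W i h) =
          (\<Sum>\<kappa>\<in>K. \<Sum>h | h \<in> ?D \<and> boundary k (C i) h = \<kappa>. f (boundary k (C i) h) * W i h)"
        by (rule sum.group[symmetric]) (use fin[OF that(1)] that(2) in auto)
      also have "\<dots> = (\<Sum>\<kappa>\<in>K. f \<kappa> *
          (\<Sum>h | h \<in> colourings k n (C i) \<and> boundary k (C i) h = \<kappa>. W i h))"
        unfolding sum_distrib_left by (intro sum.cong) auto
      finally show ?thesis by simp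
    qed
    \<comment> \<open>A nonzero value comes from a colouring of some \<open>C i\<close> with nonzero
      weight, whose spoke and parity conditions then hold for \<open>\<kappa>\<close>.\<close>
    have Z: "\<exists>i\<in>{1..l}. \<exists>h\<in>colourings k n (C i). boundary k (C i) h = \<kappa> \<and> W i h \<noteq> 0"
      if nz: "Z \<kappa> \<noteq> 0" for \<kappa>
    proof (rule ccontr)
      assume "\<not> ?thesis"
      then have "(\<Sum>h | h \<in> colourings k n (C i) \<and> boundary k (C i) h = \<kappa>. W i h) = 0"
        if "i \<in> {1..l}" for i
        using that by (intro sum.neutral) blast
      then show False using nz by (simp add: Z_def)
    qed
    have "(\<Sum>\<kappa>\<in>?K. exterior_sum k n \<Gamma> \<kappa> * Z \<kappa>) = 0"
    proof (rule sum_kernel_invariant_eq_0)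
      fix \<kappa> j b assume "Z \<kappa> \<noteq> 0" "j < k"
      from Z[OF this(1)] obtain i h where "i \<in> {1..l}" "boundary k (C i) h = \<kappa>" "W i h \<noteq> 0"
        by blast
      then show "\<kappa> (j, b) \<noteq> \<kappa> (j, \<not> b)"
        using boundary_spoke[OF assms(1), of i h j b] \<open>j < k\<close> by (simp add: W_def)
    next
      fix \<kappa> c assume "Z \<kappa> \<noteq> 0"
      from Z[OF this] obtain i h where "i \<in> {1..l}" "h \<in> colourings k n (C i)"
          "boundary k (C i) h = \<kappa>" "W i h \<noteq> 0"
        by blast
      then show "even (card {p \<in> strand_ends k. \<kappa> p = c})"
        using boundary_even[OF assms(1), of i h n c] by (simp add: W_def)
    next
      fix Cap assume Cap: "Cap \<in> caps k"
      have finCap: "finite (cap_colourings k n Cap)"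
        using finK by (simp add: cap_colourings_def)
      have "(\<Sum>\<kappa>\<in>cap_colourings k n Cap. Z \<kappa>) = (\<Sum>i=1..l. poly (a i) (of_nat n) *
          (\<Sum>\<kappa>\<in>cap_colourings k n Cap. 1 *
            (\<Sum>h | h \<in> colourings k n (C i) \<and> boundary k (C i) h = \<kappa>. W i h)))"
        unfolding Z_def by (subst sum.swap) (simp add: sum_distrib_left)
      also have "\<dots> = (\<Sum>i=1..l. poly (a i) (of_nat n) * poly (bm_capped k (C i) Cap) (of_nat n))"
        by (intro sum.cong refl arg_cong2[where f = "(*)"], subst fibres[OF _ finCap])
           (simp_all add: poly_bm_capped[OF assms(1) Cap] W_def)
      also have "\<dots> = poly (\<Sum>i=1..l. a i * bm_capped k (C i) Cap) (of_nat n)"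
        by (simp add: poly_sum)
      finally show "(\<Sum>\<kappa>\<in>cap_colourings k n Cap. Z \<kappa>) = 0"
        using assms(2)[OF Cap] by simp
    qed (use exterior_sum_same_kernel[OF \<Gamma>] in blast)
    also have "(\<Sum>\<kappa>\<in>?K. exterior_sum k n \<Gamma> \<kappa> * Z \<kappa>) = (\<Sum>i=1..l. poly (a i) (of_nat n) *
        (\<Sum>\<kappa>\<in>?K. exterior_sum k n \<Gamma> \<kappa> *
          (\<Sum>h | h \<in> colourings k n (C i) \<and> boundary k (C i) h = \<kappa>. W i h)))"
      unfolding Z_def sum_distrib_left by (subst sum.swap) (simp add: mult.left_commute)
    also have "\<dots> = (\<Sum>i=1..l. poly (a i) (of_nat n) * poly (penrose (insert_config k \<Gamma> (C i))) (of_nat n))"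
    proof (intro sum.cong refl arg_cong2[where f = "(*)"])
      fix i assume i: "i \<in> {1..l}"
      interpret insertion k \<Gamma> "C i" using \<Gamma> assms(1)[OF i] by unfold_locales
      have eq: "{h \<in> colourings k n (C i). boundary k (C i) h \<in> ?K} = colourings k n (C i)"
        using boundary_in_PiE[OF assms(1)[OF i]] by blast
      show "(\<Sum>\<kappa>\<in>?K. exterior_sum k n \<Gamma> \<kappa> *
          (\<Sum>h | h \<in> colourings k n (C i) \<and> boundary k (C i) h = \<kappa>. W i h)) =
          poly (penrose (insert_config k \<Gamma> (C i))) (of_nat n)"
        unfolding fibres[OF i finK] eq unfolding poly_penrose_insert_config W_def ..
    qed
    also have "\<dots> = poly ?p (of_nat n)"
      by (simp add: poly_sum)
    finally show ?thesis by simp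
  qed
  then have "range of_nat \<subseteq> {x. poly ?p x = 0}" by auto
  moreover have "infinite (range (of_nat :: nat \<Rightarrow> 'a))"
    by (simp add: finite_image_iff inj_of_nat)
  ultimately show "?p = 0"
    using poly_roots_finite finite_subset by blast
qed

end
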